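(* Let $p \in (0,1)$ and $s \in [0,1]$, and let $\{S_n\}$ and $\{S'_n\}$ be two independent elephant random walks with the same memory parameter $p$ and first-step parameter $s$. If $0 < p \le 3/4$, then with probability one $S_n = S'_n$ for infinitely many $n$. If $3/4 < p < 1$, then with probability one $S_n = S'_n$ for only finitely many $n$.
   Context: An elephant random walk with memory parameter $p \in (0,1)$ and first-step parameter $s \in [0,1]$ is defined as follows. Let $X_1 = +1$ with probability $s$ and $X_1 = -1$ with probability $1-s$. Let $\{U_n : n \ge 1\}$ be an independent family of random variables with $U_n$ uniformly distributed on $\{1,\dots,n\}$, also independent of $X_1$. For each $n \ge 1$, set $X_{n+1} = X_{U_n}$ with probability $p$ and $X_{n+1} = -X_{U_n}$ with probability $1-p$, where this choice is made independently of everything else. Set $S_0 = 0$ and $S_n = \sum_{i=1}^n X_i$ for $n \ge 1$. "Meeting" at time $n$ means $S_n = S'_n$. *)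

theory Defs
  imports "HOL-Probability.Probability"
begin

text \<open>Source of randomness for two elephant random walks. The boolean argument
  selects the walk (True: S, False: S').
  FirstStep w   : the first step X_1 (values +1 / -1),
  Choice w n    : U_n, uniform on {1..n}   (n >= 1),
  Flip w n      : +1 (keep, prob. p) or -1 (flip, prob. 1-p) used for X_(n+1)  (n >= 1).\<close>

datatype erw_idx = FirstStep bool | Choice bool nat | Flip bool nat

definition erw_index_set :: "erw_idx set" where
  "erw_index_set = {FirstStep w | w. True} \<union> {Choice w n | w n. 1 \<le> n} \<union> {Flip w n | w n. 1 \<le> n}"

definition sign_pmf :: "real \<Rightarrow> int pmf" where
  "sign_pmf q = map_pmf (\<lambda>b. if b then 1 else -1) (bernoulli_pmf q)"

fun erw_law :: "real \<Rightarrow> real \<Rightarrow> erw_idx \<Rightarrow> int pmf" where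
  "erw_law p s (FirstStep w) = sign_pmf s"
| "erw_law p s (Choice w n) = pmf_of_set {1..int n}"
| "erw_law p s (Flip w n) = sign_pmf p"

text \<open>The steps X_n of walk w (n >= 1): X_1 = first step,
  X_(n+1) = Flip_n * X_(U_n). (X_0 = 0 is a dummy value.)\<close>
function erw_X :: "(erw_idx \<Rightarrow> int) \<Rightarrow> bool \<Rightarrow> nat \<Rightarrow> int" where
  "erw_X \<xi> w 0 = 0"
| "erw_X \<xi> w (Suc 0) = \<xi> (FirstStep w)"
| "erw_X \<xi> w (Suc (Suc n)) =
     (if 1 \<le> \<xi> (Choice w (Suc n)) \<and> \<xi> (Choice w (Suc n)) \<le> int (Suc n)
      then \<xi> (Flip w (Suc n)) * erw_X \<xi> w (nat (\<xi> (Choice w (Suc n))))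
      else 0)"
  by pat_completeness auto
termination
  by (relation "Wellfounded.measure (\<lambda>(_, _, n). n)") auto

definition erw_S :: "(erw_idx \<Rightarrow> int) \<Rightarrow> bool \<Rightarrow> nat \<Rightarrow> int" where
  "erw_S \<xi> w n = (\<Sum>i=1..n. erw_X \<xi> w i)"

end

theory Submission
  imports Defs
begin

text \<open>
  Write \<open>D = S - S'\<close>. Given the past, \<open>D\<close> at time \<open>n\<close> has drift \<open>(2 p - 1) D / n\<close> and steps in
  \<open>{-2, 0, 2}\<close>; as \<open>D\<close> is even it cannot change sign without vanishing.

  If \<open>p \<le> 3/4\<close>, then \<open>M = \<bar>D\<bar> / sqrt (n - 1)\<close> is a nonnegative supermartingale until \<open>D\<close> vanishes, with
  conditional variance of order \<open>1 / n\<close>. Hence the mean of \<open>1 - exp (- \<lambda> M)\<close> before the next meeting drops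
  at each step by a multiple of \<open>1 / n\<close> times the mean of \<open>exp (- \<lambda> M)\<close>. The harmonic series diverges, so
  the probability of no meeting since time \<open>N\<close> has a limit which is at most \<open>\<lambda>\<close> times the mean of \<open>M\<close> at
  time \<open>N\<close>; now let \<open>\<lambda>\<close> tend to \<open>0\<close>.

  If \<open>p > 3/4\<close>, then for large \<open>B\<close> the function \<open>h = n / (B n + D\<^sup>2)\<close> contracts in mean by a factor
  \<open>1 - \<rho> / n\<close>, so its mean tends to \<open>0\<close>. As \<open>h\<close> takes its maximum \<open>1 / B\<close> at meetings, the maximal
  inequality bounds the probability of a meeting after time \<open>N\<close> by \<open>B\<close> times the mean of \<open>h\<close> at time \<open>N\<close>.
\<close>

section \<open>Laws of finite histories of the walks\<close>

text \<open>Moves events of finitely many coordinates from the abstract space to a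
  \<open>Pi_pmf\<close>. Under both measures the joint law of these coordinates is the product of
  the marginals, and \<open>R\<close> sees nothing else.\<close>

lemma (in prob_space) prob_eq_Pi_pmf:
  fixes X :: "'i \<Rightarrow> 'a \<Rightarrow> 'b::countable" and L :: "'i \<Rightarrow> 'b pmf"
  assumes ind: "indep_vars (\<lambda>_. count_space UNIV) X I"
    and J: "finite J" "J \<noteq> {}" "J \<subseteq> I"
    and law: "\<And>i. i \<in> J \<Longrightarrow> distr M (count_space UNIV) (X i) = measure_pmf (L i)"
    and R: "\<And>f g. (\<And>i. i \<in> J \<Longrightarrow> f i = g i) \<Longrightarrow> R f = R g"
  shows "{\<omega> \<in> space M. R (\<lambda>i. X i \<omega>)} \<in> events"
    and "prob {\<omega> \<in> space M. R (\<lambda>i. X i \<omega>)} = measure_pmf.prob (Pi_pmf J d L) {f. R f}"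
proof -
  let ?P = "PiM J (\<lambda>_. count_space (UNIV :: 'b set))"
  let ?Q = "measure_pmf (Pi_pmf J d L)"
  have rv: "random_variable (count_space UNIV) (X i)" if "i \<in> J" for i
    using ind J that by (auto simp: indep_vars_def2)
  have meas[measurable]: "(\<lambda>x. \<lambda>i\<in>J. X i x) \<in> measurable M ?P"
    by (intro measurable_restrict rv)
  have meas'[measurable]: "(\<lambda>x. \<lambda>i\<in>J. x i) \<in> measurable ?Q ?P"
    by (intro measurable_restrict) auto
  \<comment> \<open>With countable values and finitely many coordinates every set of tuples is
    measurable, in particular \<open>A\<close> below.\<close>
  have P: "?P = count_space (PiE J (\<lambda>_. UNIV))"
    by (rule count_space_PiM_finite[OF J(1)]) auto
  have "distr M ?P (\<lambda>x. \<lambda>i\<in>J. X i x) = PiM J (\<lambda>i. distr M (count_space UNIV) (X i))"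
    using indep_vars_subset[OF ind J(3)] by (subst (asm) indep_vars_iff_distr_eq_PiM'[OF J(2) rv])
  also have "\<dots> = PiM J (\<lambda>i. measure_pmf (L i))"
    by (intro PiM_cong refl law)
  also have "\<dots> = PiM J (\<lambda>i. distr ?Q (count_space UNIV) (\<lambda>f. f i))"
    using J(1) by (intro PiM_cong refl) (simp flip: map_pmf_rep_eq add: Pi_pmf_component)
  also have "\<dots> = distr ?Q ?P (\<lambda>f. \<lambda>i\<in>J. f i)"
    using indep_vars_Pi_pmf[OF J(1), of d L]
    by (subst (asm) prob_space.indep_vars_iff_distr_eq_PiM'[OF measure_pmf.prob_space_axioms J(2)]) auto
  finally have eq: "distr M ?P (\<lambda>x. \<lambda>i\<in>J. X i x) = distr ?Q ?P (\<lambda>f. \<lambda>i\<in>J. f i)" .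
  define A where "A = {f \<in> PiE J (\<lambda>_. UNIV). R f}"
  have A[measurable]: "A \<in> sets ?P"
    unfolding P A_def by auto
  have 1: "(\<lambda>x. \<lambda>i\<in>J. X i x) -` A \<inter> space M = {\<omega> \<in> space M. R (\<lambda>i. X i \<omega>)}"
    unfolding A_def by (auto cong: conj_cong intro: R[THEN iffD1, rotated])
  have 2: "(\<lambda>f. \<lambda>i\<in>J. f i) -` A \<inter> space ?Q = {f. R f}"
    unfolding A_def by (auto cong: conj_cong intro: R[THEN iffD1, rotated])
  show "{\<omega> \<in> space M. R (\<lambda>i. X i \<omega>)} \<in> events"
    using measurable_sets[OF meas A] 1 by simp
  have "measure (distr M ?P (\<lambda>x. \<lambda>i\<in>J. X i x)) A = measure (distr ?Q ?P (\<lambda>f. \<lambda>i\<in>J. f i)) A"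
    by (simp add: eq)
  then show "prob {\<omega> \<in> space M. R (\<lambda>i. X i \<omega>)} = measure_pmf.prob (Pi_pmf J d L) {f. R f}"
    by (simp only: measure_distr[OF meas A] measure_distr[OF meas' A] 1 2)
qed

text \<open>Fubini in discrete form, drawing the new coordinate last. Finite supports turn all
  expectations into finite sums.\<close>

lemma expectation_Pi_pmf_insert:
  fixes h :: "('a \<Rightarrow> 'b) \<Rightarrow> real"
  assumes "finite A" "x \<notin> A" "\<And>y. finite (set_pmf (p y))"
  shows "measure_pmf.expectation (Pi_pmf (insert x A) d p) h =
    measure_pmf.expectation (Pi_pmf A d p) (\<lambda>f. measure_pmf.expectation (p x) (\<lambda>y. h (f(x := y))))"
proof -
  let ?Q = "Pi_pmf A d p"
  have fin: "finite (set_pmf ?Q)"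
    using assms by (simp add: set_Pi_pmf finite_PiE_dflt)
  have "Pi_pmf (insert x A) d p = bind_pmf ?Q (\<lambda>f. map_pmf (\<lambda>y. f(x := y)) (p x))"
    using assms by (simp add: Pi_pmf_insert' map_pmf_def bind_commute_pmf[of "p x"])
  also have "measure_pmf.expectation \<dots> h = (\<Sum>f\<in>set_pmf ?Q. pmf ?Q f *\<^sub>R measure_pmf.expectation (p x) (\<lambda>y. h (f(x := y))))"
    using assms(3) by (subst pmf_expectation_bind[OF fin]) auto
  also have "\<dots> = measure_pmf.expectation ?Q (\<lambda>f. measure_pmf.expectation (p x) (\<lambda>y. h (f(x := y))))"
    by (subst integral_measure_pmf[OF fin]) auto
  finally show ?thesis .
qed

section \<open>Finite histories of the two walks\<close>

definition hist_indices :: "nat \<Rightarrow> erw_idx set" where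
  "hist_indices n = range FirstStep \<union> (\<lambda>(w, k). Choice w k) ` (UNIV \<times> {1..<n})
     \<union> (\<lambda>(w, k). Flip w k) ` (UNIV \<times> {1..<n})"

text \<open>The variables with number \<open>k\<close> produce step \<open>k + 1\<close>, so the
  positions up to time \<open>n\<close> use only \<open>k < n\<close>.\<close>

lemma in_hist_indices [simp]:
  "FirstStep w \<in> hist_indices n"
  "Choice w k \<in> hist_indices n \<longleftrightarrow> 1 \<le> k \<and> k < n"
  "Flip w k \<in> hist_indices n \<longleftrightarrow> 1 \<le> k \<and> k < n"
  by (auto simp: hist_indices_def)

lemma finite_hist_indices [simp]: "finite (hist_indices n)"
  by (simp add: hist_indices_def)

lemma hist_indices_Suc:
  assumes "1 \<le> n"
  shows "hist_indices (Suc n) = insert (Choice True n) (insert (Flip True n)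
    (insert (Choice False n) (insert (Flip False n) (hist_indices n))))"
proof -
  have "i \<in> hist_indices (Suc n) \<longleftrightarrow> i \<in> insert (Choice True n) (insert (Flip True n)
    (insert (Choice False n) (insert (Flip False n) (hist_indices n))))" for i
    using assms by (cases i) auto
  then show ?thesis by blast
qed

lemma hist_indices_subset: "hist_indices n \<subseteq> erw_index_set"
  by (auto simp: hist_indices_def erw_index_set_def)

lemma erw_X_cong:
  assumes "f (FirstStep w) = g (FirstStep w)"
    and "\<And>k. 1 \<le> k \<Longrightarrow> k < n \<Longrightarrow> f (Choice w k) = g (Choice w k) \<and> f (Flip w k) = g (Flip w k)"
    and "k \<le> n"
  shows "erw_X f w k = erw_X g w k"
  using assms(3)
proof (induction k rule: less_induct)
  case (less k)
  consider "k = 0" | "k = 1" | m where "k = Suc (Suc m)"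
    by (metis One_nat_def not0_implies_Suc)
  then show ?case
  proof cases
    case 3
    have "f (Choice w (Suc m)) = g (Choice w (Suc m))" "f (Flip w (Suc m)) = g (Flip w (Suc m))"
      using assms(2)[of "Suc m"] 3 less.prems by auto
    then show ?thesis using 3 less by auto
  qed (use assms(1) in auto)
qed

lemma erw_S_cong:
  assumes "f (FirstStep w) = g (FirstStep w)"
    and "\<And>k. 1 \<le> k \<Longrightarrow> k < n \<Longrightarrow> f (Choice w k) = g (Choice w k) \<and> f (Flip w k) = g (Flip w k)"
    and "k \<le> n"
  shows "erw_S f w k = erw_S g w k"
  unfolding erw_S_def using assms by (intro sum.cong refl erw_X_cong[where n = n]) auto

lemma erw_S_Suc: "erw_S f w (Suc n) = erw_S f w n + erw_X f w (Suc n)"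
  by (simp add: erw_S_def)

text \<open>The almost sure constraints on a history. They rule out the default branch of
  \<open>erw_X\<close>, so that every step is a sign.\<close>

definition regular :: "nat \<Rightarrow> (erw_idx \<Rightarrow> int) \<Rightarrow> bool" where
  "regular n f \<longleftrightarrow> (\<forall>w. \<bar>f (FirstStep w)\<bar> = 1 \<and>
     (\<forall>k\<in>{1..<n}. f (Choice w k) \<in> {1..int k} \<and> \<bar>f (Flip w k)\<bar> = 1))"

lemma erw_X_regular:
  assumes "regular n f" "1 \<le> k" "k \<le> n"
  shows "\<bar>erw_X f w k\<bar> = 1"
  using assms(2,3)
proof (induction k rule: less_induct)
  case (less k)
  consider "k = 1" | m where "k = Suc (Suc m)"
    using less.prems by (metis One_nat_def not0_implies_Suc not_one_le_zero)
  then show ?case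
  proof cases
    case 2
    have "f (Choice w (Suc m)) \<in> {1..int (Suc m)}" "\<bar>f (Flip w (Suc m))\<bar> = 1"
      using assms(1)[unfolded regular_def, rule_format, of w]
        bspec[of "{1..<n}" "\<lambda>k. f (Choice w k) \<in> {1..int k} \<and> \<bar>f (Flip w k)\<bar> = 1" "Suc m"] 2 less.prems
      by auto
    then show ?thesis using 2 less by (auto simp: abs_mult)
  qed (use assms(1) in \<open>auto simp: regular_def\<close>)
qed

text \<open>Every step is odd, so a position has the parity of its time; two walks at the same time
  thus differ by an even number.\<close>

lemma erw_S_regular:
  assumes "regular n f"
  shows "\<bar>erw_S f w n\<bar> \<le> int n" and "even (erw_S f w n - int n)"
proof -
  have "\<bar>erw_S f w n\<bar> \<le> (\<Sum>i=1..n. \<bar>erw_X f w i\<bar>)"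
    unfolding erw_S_def by (rule sum_abs)
  also have "\<dots> = (\<Sum>i=1..n. 1)"
    using assms by (intro sum.cong) (auto simp: erw_X_regular)
  finally show "\<bar>erw_S f w n\<bar> \<le> int n" by simp
  have "erw_S f w n - int n = (\<Sum>i=1..n. erw_X f w i - 1)"
    by (simp add: erw_S_def sum_subtractf)
  also have "even \<dots>"
  proof (rule dvd_sum)
    fix i assume "i \<in> {1..n}"
    then have "\<bar>erw_X f w i\<bar> = 1" using assms by (auto intro: erw_X_regular)
    then show "2 dvd erw_X f w i - 1" by (cases "erw_X f w i \<ge> 0") auto
  qed
  finally show "even (erw_S f w n - int n)" .
qed

section \<open>Averaging over the next step\<close>

lemma set_sign_pmf: "set_pmf (sign_pmf q) \<subseteq> {1, -1}"
  by (auto simp: sign_pmf_def)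

lemma expectation_sign_pmf:
  assumes "0 \<le> q" "q \<le> 1"
  shows "measure_pmf.expectation (sign_pmf q) h = h 1 * q + h (-1) * (1 - q :: real)"
  using assms by (simp add: sign_pmf_def)

lemma set_erw_law_Choice: "1 \<le> n \<Longrightarrow> set_pmf (erw_law p s (Choice w n)) = {1..int n}"
  by (subst erw_law.simps) (simp add: set_pmf_of_set)

lemma finite_set_erw_law:
  assumes "i \<in> erw_index_set"
  shows "finite (set_pmf (erw_law p s i))"
  using assms
  by (cases i) (auto simp: erw_index_set_def set_erw_law_Choice simp del: erw_law.simps(2)
      intro: finite_subset[OF set_sign_pmf])

abbreviation history_pmf :: "real \<Rightarrow> real \<Rightarrow> nat \<Rightarrow> (erw_idx \<Rightarrow> int) pmf" where
  "history_pmf p s n \<equiv> Pi_pmf (hist_indices n) 0 (erw_law p s)"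

lemma regular_Pi_pmf:
  assumes "f \<in> set_pmf (Pi_pmf A 0 (erw_law p s))" "finite A" "hist_indices n \<subseteq> A"
  shows "regular n f"
proof -
  have *: "f i \<in> set_pmf (erw_law p s i)" if "i \<in> hist_indices n" for i
    using assms that by (auto simp: set_Pi_pmf PiE_dflt_def)
  show ?thesis
    unfolding regular_def
  proof (intro allI conjI ballI)
    fix w
    show "\<bar>f (FirstStep w)\<bar> = 1"
      using *[of "FirstStep w"] set_sign_pmf[of s] by auto
    fix k assume k: "k \<in> {1..<n}"
    show "f (Choice w k) \<in> {1..int k}"
      using *[of "Choice w k"] k by (auto simp: set_erw_law_Choice simp del: erw_law.simps)
    show "\<bar>f (Flip w k)\<bar> = 1"
      using *[of "Flip w k"] k set_sign_pmf[of p] by auto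
  qed
qed

text \<open>Integrates out the two variables behind step \<open>n + 1\<close> of walk
  \<open>w\<close>. The uniform choice gives the remembered step the mean \<open>S / n\<close>, the
  flip multiplies this by \<open>2 p - 1\<close>, and the law of a sign is determined by its mean.
  \<open>A\<close> may contain the variables of the other walk, so the walks can be treated one
  after the other.\<close>

lemma expectation_half_step:
  fixes \<Psi> :: "(erw_idx \<Rightarrow> int) \<Rightarrow> int \<Rightarrow> real" and p :: real
  assumes p: "0 \<le> p" "p \<le> 1" and n: "1 \<le> n"
    and A: "finite A" "Choice w n \<notin> A" "Flip w n \<notin> A" "hist_indices n \<subseteq> A" "A \<subseteq> erw_index_set"
    and \<Psi>: "\<And>f a b x. \<Psi> (f(Flip w n := b, Choice w n := a)) x = \<Psi> f x"
  shows "measure_pmf.expectation (Pi_pmf (insert (Choice w n) (insert (Flip w n) A)) 0 (erw_law p s))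
      (\<lambda>f. \<Psi> f (erw_X f w (Suc n)))
    = measure_pmf.expectation (Pi_pmf A 0 (erw_law p s))
      (\<lambda>f. \<Sum>x\<in>{1, -1}. (1 + x * (2 * p - 1) * erw_S f w n / n) / 2 * \<Psi> f x)"
proof -
  let ?L = "erw_law p s"
  \<comment> \<open>\<open>expectation_Pi_pmf_insert\<close> asks for finite support at every index,
    but \<open>erw_law\<close> at \<open>Choice w 0\<close> is \<open>pmf_of_set\<close> of the
    empty set. \<open>L'\<close> repairs the law off \<open>erw_index_set\<close>.\<close>
  define L' where "L' i = (if i \<in> erw_index_set then ?L i else return_pmf 0)" for i
  have idx: "Choice w n \<in> erw_index_set" "Flip w n \<in> erw_index_set"
    using n by (auto simp: erw_index_set_def)
  have L': "finite (set_pmf (L' i))" for i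
    by (auto simp: L'_def finite_set_erw_law)
  have LL: "Pi_pmf B 0 ?L = Pi_pmf B 0 L'" if "B \<subseteq> erw_index_set" for B
    unfolding L'_def using that by (intro Pi_pmf_cong) auto
  have step: "measure_pmf.expectation (?L (Flip w n)) (\<lambda>b. measure_pmf.expectation (?L (Choice w n))
      (\<lambda>a. \<Psi> (f(Flip w n := b, Choice w n := a)) (erw_X (f(Flip w n := b, Choice w n := a)) w (Suc n))))
    = (\<Sum>x\<in>{1, -1}. (1 + x * (2 * p - 1) * erw_S f w n / n) / 2 * \<Psi> f x)"
    (is "?lhs = ?rhs")
    if reg: "regular n f" for f
  proof -
    obtain m where m: "n = Suc m" using n by (cases n) auto
    have X: "erw_X (f(Flip w n := b, Choice w n := a)) w (Suc n) = b * erw_X f w (nat a)"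
      if a: "a \<in> {1..int n}" for a b
    proof -
      have "erw_X (f(Flip w n := b, Choice w n := a)) w (nat a) = erw_X f w (nat a)"
        by (rule erw_X_cong[where n = n]) (use a in auto)
      then show ?thesis using a m by auto
    qed
    have inner: "measure_pmf.expectation (?L (Choice w n))
      (\<lambda>a. \<Psi> (f(Flip w n := b, Choice w n := a)) (erw_X (f(Flip w n := b, Choice w n := a)) w (Suc n)))
      = (\<Psi> f 1 + \<Psi> f (-1)) / 2 + b * erw_S f w n / n * (\<Psi> f 1 - \<Psi> f (-1)) / 2" if b: "b \<in> {1, -1}" for b
    proof -
      have "measure_pmf.expectation (?L (Choice w n))
        (\<lambda>a. \<Psi> (f(Flip w n := b, Choice w n := a)) (erw_X (f(Flip w n := b, Choice w n := a)) w (Suc n)))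
        = (\<Sum>a\<in>{1..int n}. \<Psi> f (erw_X (f(Flip w n := b, Choice w n := a)) w (Suc n))) / n"
        unfolding erw_law.simps \<Psi> using n by (subst integral_pmf_of_set) auto
      \<comment> \<open>A function of a sign is affine in that sign, so only the sum of the past
        steps enters.\<close>
      also have "(\<Sum>a\<in>{1..int n}. \<Psi> f (erw_X (f(Flip w n := b, Choice w n := a)) w (Suc n)))
        = (\<Sum>a\<in>{1..int n}. (\<Psi> f 1 + \<Psi> f (-1)) / 2 + b * erw_X f w (nat a) * ((\<Psi> f 1 - \<Psi> f (-1)) / 2))"
      proof (intro sum.cong refl)
        fix a assume a: "a \<in> {1..int n}"
        then have "\<bar>erw_X f w (nat a)\<bar> = 1"
          by (intro erw_X_regular[OF reg]) auto
        then have "erw_X f w (nat a) = 1 \<or> erw_X f w (nat a) = -1" by linarith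
        then show "\<Psi> f (erw_X (f(Flip w n := b, Choice w n := a)) w (Suc n))
          = (\<Psi> f 1 + \<Psi> f (-1)) / 2 + b * erw_X f w (nat a) * ((\<Psi> f 1 - \<Psi> f (-1)) / 2)"
          unfolding X[OF a] using b by (auto simp: field_simps)
      qed
      also have "\<dots> = n * ((\<Psi> f 1 + \<Psi> f (-1)) / 2)
          + b * (\<Sum>a\<in>{1..int n}. real_of_int (erw_X f w (nat a))) * ((\<Psi> f 1 - \<Psi> f (-1)) / 2)"
        by (simp only: sum.distrib sum_distrib_right[symmetric] sum_distrib_left[symmetric])
             (simp add: sum_distrib_left)
      also have "(\<Sum>a\<in>{1..int n}. real_of_int (erw_X f w (nat a))) = (\<Sum>i=1..n. real_of_int (erw_X f w i))"
        by (rule sum.reindex_bij_witness[where i = int and j = nat]) auto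
      also have "\<dots> = erw_S f w n" by (simp add: erw_S_def)
      also have "(n * ((\<Psi> f 1 + \<Psi> f (-1)) / 2) + b * real_of_int (erw_S f w n) * ((\<Psi> f 1 - \<Psi> f (-1)) / 2)) / n
        = (\<Psi> f 1 + \<Psi> f (-1)) / 2 + b * erw_S f w n / n * (\<Psi> f 1 - \<Psi> f (-1)) / 2"
        using n by (simp add: field_simps)
      finally show ?thesis .
    qed
    have "?lhs = measure_pmf.expectation (sign_pmf p) (\<lambda>b. (\<Psi> f 1 + \<Psi> f (-1)) / 2
        + b * erw_S f w n / n * (\<Psi> f 1 - \<Psi> f (-1)) / 2)"
      unfolding erw_law.simps(3)
      by (intro integral_cong_AE AE_pmfI inner) (use set_sign_pmf in auto)
    also have "\<dots> = ?rhs"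
      using p n by (simp add: expectation_sign_pmf field_simps)
    finally show ?thesis .
  qed
  have "measure_pmf.expectation (Pi_pmf (insert (Choice w n) (insert (Flip w n) A)) 0 ?L)
      (\<lambda>f. \<Psi> f (erw_X f w (Suc n)))
    = measure_pmf.expectation (Pi_pmf A 0 L') (\<lambda>f. measure_pmf.expectation (L' (Flip w n))
       (\<lambda>b. measure_pmf.expectation (L' (Choice w n)) (\<lambda>a. \<Psi> (f(Flip w n := b, Choice w n := a))
         (erw_X (f(Flip w n := b, Choice w n := a)) w (Suc n)))))"
    using A idx L' by (simp add: LL expectation_Pi_pmf_insert)
  also have "\<dots> = measure_pmf.expectation (Pi_pmf A 0 L')
      (\<lambda>f. \<Sum>x\<in>{1, -1}. (1 + x * (2 * p - 1) * erw_S f w n / n) / 2 * \<Psi> f x)"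
  proof (intro integral_cong_AE AE_pmfI)
    fix f assume "f \<in> set_pmf (Pi_pmf A 0 L')"
    then have "regular n f" using A by (auto simp flip: LL intro: regular_Pi_pmf)
    from step[OF this] idx show "measure_pmf.expectation (L' (Flip w n))
       (\<lambda>b. measure_pmf.expectation (L' (Choice w n)) (\<lambda>a. \<Psi> (f(Flip w n := b, Choice w n := a))
         (erw_X (f(Flip w n := b, Choice w n := a)) w (Suc n))))
      = (\<Sum>x\<in>{1, -1}. (1 + x * (2 * p - 1) * erw_S f w n / n) / 2 * \<Psi> f x)"
      by (simp add: L'_def del: erw_law.simps)
  qed auto
  finally show ?thesis using LL A by simp
qed

lemma integrable_history [simp]:
  fixes h :: "(erw_idx \<Rightarrow> int) \<Rightarrow> real"
  shows "integrable (measure_pmf (history_pmf p s n)) h"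
proof (rule integrable_measure_pmf_finite)
  have "finite (set_pmf (erw_law p s i))" if "i \<in> hist_indices n" for i
    using finite_set_erw_law hist_indices_subset that by blast
  then show "finite (set_pmf (history_pmf p s n))"
    by (simp add: set_Pi_pmf finite_PiE_dflt)
qed

lemma expectation_history_mono:
  fixes g h :: "(erw_idx \<Rightarrow> int) \<Rightarrow> real"
  assumes "\<And>f. regular n f \<Longrightarrow> g f \<le> h f"
  shows "measure_pmf.expectation (history_pmf p s n) g \<le> measure_pmf.expectation (history_pmf p s n) h"
  using assms by (intro integral_mono_AE AE_pmfI) (auto intro!: assms regular_Pi_pmf[OF _ finite_hist_indices subset_refl])

text \<open>Transition operator of the two walks at time \<open>n\<close>: given the past, the next step is \<open>x\<close> with
  probability \<open>(1 + x (2 p - 1) S / n) / 2\<close>, since the remembered step has mean \<open>S / n\<close>.\<close>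

definition pair_step :: "real \<Rightarrow> nat \<Rightarrow> (int \<Rightarrow> int \<Rightarrow> real) \<Rightarrow> int \<Rightarrow> int \<Rightarrow> real" where
  "pair_step p n u a b = (\<Sum>x\<in>{1, -1}. \<Sum>y\<in>{1, -1}.
     (1 + x * (2 * p - 1) * a / n) / 2 * ((1 + y * (2 * p - 1) * b / n) / 2) * u (a + x) (b + y))"

text \<open>\<open>I\<close> stands for information on the past, later the event of no meeting yet.
  The half step is taken first for walk \<open>True\<close>, then for walk \<open>False\<close>,
  whose variables at time \<open>n\<close> are kept in \<open>?A\<close> meanwhile.\<close>

lemma expectation_step:
  fixes I :: "(erw_idx \<Rightarrow> int) \<Rightarrow> real"
  assumes p: "0 \<le> p" "p \<le> 1" and n: "1 \<le> n"
    and I: "\<And>f g. (\<And>i. i \<in> hist_indices n \<Longrightarrow> f i = g i) \<Longrightarrow> I f = I g"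
  shows "measure_pmf.expectation (history_pmf p s (Suc n))
      (\<lambda>f. I f * u (erw_S f True (Suc n)) (erw_S f False (Suc n)))
    = measure_pmf.expectation (history_pmf p s n)
      (\<lambda>f. I f * pair_step p n u (erw_S f True n) (erw_S f False n))"
proof -
  let ?A = "insert (Choice False n) (insert (Flip False n) (hist_indices n))"
  let ?q = "\<lambda>x f w. (1 + real_of_int x * (2 * p - 1) * real_of_int (erw_S f w n) / real n) / 2"
  define \<Psi>1 where "\<Psi>1 f x = I f * u (erw_S f True n + x) (erw_S f False (Suc n))" for f x
  define \<Psi>2 where "\<Psi>2 f y = (\<Sum>x\<in>{1, -1}. ?q x f True * (I f * u (erw_S f True n + x) (erw_S f False n + y)))" for f y
  have sub: "?A \<subseteq> erw_index_set"
    using hist_indices_subset[of n] n by (auto simp: erw_index_set_def)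
  have I1: "I (f(Flip w n := b, Choice w n := a)) = I f" for f w a b
    by (rule I) (use n in auto)
  have S1: "erw_S (f(Flip w n := b, Choice w n := a)) w' n = erw_S f w' n" for f w w' a b
    by (rule erw_S_cong[where n = n]) auto
  have S2: "erw_S (f(Flip True n := b, Choice True n := a)) False (Suc n) = erw_S f False (Suc n)" for f a b
    by (rule erw_S_cong[where n = "Suc n"]) auto
  have "measure_pmf.expectation (history_pmf p s (Suc n))
      (\<lambda>f. I f * u (erw_S f True (Suc n)) (erw_S f False (Suc n)))
    = measure_pmf.expectation (Pi_pmf (insert (Choice True n) (insert (Flip True n) ?A)) 0 (erw_law p s))
      (\<lambda>f. \<Psi>1 f (erw_X f True (Suc n)))"
    using n by (simp add: hist_indices_Suc \<Psi>1_def erw_S_Suc)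
  also have "\<dots> = measure_pmf.expectation (Pi_pmf ?A 0 (erw_law p s)) (\<lambda>f. \<Sum>x\<in>{1, -1}. ?q x f True * \<Psi>1 f x)"
    by (rule expectation_half_step[where w = True and \<Psi> = \<Psi>1, OF p n])
      (use sub in \<open>auto simp: \<Psi>1_def I1 S1 S2\<close>)
  also have "\<dots> = measure_pmf.expectation (Pi_pmf ?A 0 (erw_law p s)) (\<lambda>f. \<Psi>2 f (erw_X f False (Suc n)))"
    by (simp add: \<Psi>1_def \<Psi>2_def erw_S_Suc)
  also have "\<dots> = measure_pmf.expectation (history_pmf p s n) (\<lambda>f. \<Sum>y\<in>{1, -1}. ?q y f False * \<Psi>2 f y)"
    by (rule expectation_half_step[where w = False and \<Psi> = \<Psi>2, OF p n])
      (use hist_indices_subset[of n] in \<open>auto simp: \<Psi>2_def I1 S1\<close>)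
  also have "\<dots> = measure_pmf.expectation (history_pmf p s n)
      (\<lambda>f. I f * pair_step p n u (erw_S f True n) (erw_S f False n))"
    unfolding \<Psi>2_def pair_step_def sum_distrib_left
    by (intro Bochner_Integration.integral_cong refl, subst sum.swap) (intro sum.cong refl, simp add: mult_ac)
  finally show ?thesis .
qed

lemma pair_step_expand:
  fixes a b :: int and p :: real and n :: nat
  defines "\<mu> \<equiv> (2 * p - 1) * a / n" and "\<nu> \<equiv> (2 * p - 1) * b / n"
  shows "pair_step p n u a b =
    ((1 + \<mu>) * (1 + \<nu>) * u (a + 1) (b + 1) + (1 + \<mu>) * (1 - \<nu>) * u (a + 1) (b - 1)
     + (1 - \<mu>) * (1 + \<nu>) * u (a - 1) (b + 1) + (1 - \<mu>) * (1 - \<nu>) * u (a - 1) (b - 1)) / 4"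
proof -
  have *: "real_of_int x * (2 * p - 1) * a / n = x * \<mu>" "real_of_int x * (2 * p - 1) * b / n = x * \<nu>" for x
    by (simp_all add: \<mu>_def \<nu>_def)
  show ?thesis unfolding pair_step_def * by (simp add: field_simps)
qed

lemma pair_step_const [simp]: "pair_step p n (\<lambda>_ _. c) a b = c"
proof -
  have "((1 + \<mu>) * (1 + \<nu>) * c + (1 + \<mu>) * (1 - \<nu>) * c + (1 - \<mu>) * (1 + \<nu>) * c
    + (1 - \<mu>) * (1 - \<nu>) * c) / 4 = c" for \<mu> \<nu> :: real
    by (simp add: algebra_simps)
  then show ?thesis unfolding pair_step_expand .
qed

lemma pair_step_mono:
  assumes "0 \<le> p" "p \<le> 1" "\<bar>a\<bar> \<le> int n" "\<bar>b\<bar> \<le> int n"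
    and "\<And>x y. x \<in> {1, -1} \<Longrightarrow> y \<in> {1, -1} \<Longrightarrow> u (a + x) (b + y) \<le> v (a + x) (b + y)"
  shows "pair_step p n u a b \<le> pair_step p n v a b"
proof -
  have w: "0 \<le> (1 + real_of_int x * (2 * p - 1) * real_of_int c / real n) / 2"
    if "x \<in> {1, -1}" "\<bar>c\<bar> \<le> int n" for x c
  proof -
    have "\<bar>2 * p - 1\<bar> * \<bar>real_of_int c / real n\<bar> \<le> 1 * 1"
      using that assms(1,2) by (intro mult_mono) (auto simp: field_simps divide_le_eq_1)
    moreover define t where "t = (2 * p - 1) * (real_of_int c / real n)"
    ultimately have "\<bar>t\<bar> \<le> 1" by (simp add: abs_mult)
    then have "0 \<le> 1 + real_of_int x * t"
      using that(1) by auto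
    then show ?thesis by (simp add: t_def mult.assoc)
  qed
  show ?thesis
    unfolding pair_step_def
    by (intro sum_mono mult_left_mono assms mult_nonneg_nonneg w) auto
qed

text \<open>Telescoping bounds every partial sum of \<open>c / k\<close> from \<open>n0\<close> on
  by \<open>x n0\<close>, against the divergence of the harmonic series.\<close>

lemma no_harmonic_decrease:
  fixes x :: "nat \<Rightarrow> real"
  assumes "c > 0" "\<And>n. n \<ge> n0 \<Longrightarrow> x n \<ge> 0"
    and "\<And>n. n \<ge> n0 \<Longrightarrow> x (Suc n) \<le> x n - c / n"
  shows False
proof -
  have "(\<Sum>k<m. c / real (k + n0)) \<le> x n0 - x (n0 + m)" for m
  proof (induction m)
    case (Suc m)
    then show ?case using assms(3)[of "n0 + m"] by (simp add: add.commute)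
  qed simp
  then have "(\<Sum>k<m. c / real (k + n0)) \<le> x n0" for m
    using assms(2)[of "n0 + m"] by (smt (verit) le_add1)
  then have "summable (\<lambda>k. c / real (k + n0))"
    using assms(1) by (intro summableI_nonneg_bounded[of _ "x n0"]) auto
  then have "summable (\<lambda>k. c / real k)" using summable_iff_shift[of "\<lambda>k. c / real k" n0] by simp
  then have "summable (\<lambda>k. (1 / c) * (c / real k))" by (rule summable_mult)
  then show False using assms(1) not_summable_harmonic[where 'a = real] by (simp add: inverse_eq_divide)
qed

section \<open>One-step estimates\<close>

lemma inverse_sqrt_drift:
  fixes n :: real
  assumes "n \<ge> 2"
  shows "(1 + 1 / (2 * n)) / sqrt n \<le> 1 / sqrt (n - 1)"
proof (rule power2_le_imp_le)
  \<comment> \<open>At \<open>p = 3/4\<close> the gap grows in mean by the factor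
    \<open>1 + 1 / (2 n)\<close>; normalising by \<open>sqrt (n - 1)\<close> at time
    \<open>n\<close> absorbs exactly this kind of growth.\<close>
  have "(1 + 1 / (2 * n))\<^sup>2 * (n - 1) \<le> n"
    using assms by (simp add: power2_eq_square field_simps)
  then show "((1 + 1 / (2 * n)) / sqrt n)\<^sup>2 \<le> (1 / sqrt (n - 1))\<^sup>2"
    using assms by (simp add: power_divide divide_le_eq pos_le_divide_eq mult.commute)
qed (use assms in auto)

text \<open>Squares \<open>1 - y / 2 \<le> exp (- y / 2)\<close>; the bound on \<open>y\<close>
  keeps the left side nonnegative. The quadratic term has to survive, since the variance of the
  steps enters through it.\<close>

lemma exp_neg_ge:
  fixes y :: real
  assumes "y \<le> 2"
  shows "1 - y + y\<^sup>2 / 4 \<le> exp (- y)"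
proof -
  have "(1 - y / 2)\<^sup>2 \<le> (exp (- y / 2))\<^sup>2"
    using assms exp_ge_add_one_self[of "- y / 2"] by (intro power_mono) auto
  also have "(exp (- y / 2))\<^sup>2 = exp (- y)"
    by (simp flip: exp_double)
  finally show ?thesis by (simp add: power2_eq_square algebra_simps)
qed

text \<open>Here \<open>m\<close> is the gap, and \<open>u\<close> and \<open>v\<close> are the mean
  steps of the leading and the trailing walk. The drift bound makes the first-order change of the
  exponential favourable, and the step variance \<open>2 - u\<^sup>2 - v\<^sup>2\<close> supplies a
  gain of order \<open>1 / n\<close>.\<close>

lemma exp_weighted_ge:
  fixes m n l u v \<alpha> :: real
  defines "e \<equiv> \<lambda>t. exp (- (l * t / sqrt n))"
  assumes n: "n \<ge> 2" and m: "m \<ge> 2" and l: "0 \<le> l" "l \<le> sqrt n"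
    and uv: "u\<^sup>2 \<le> \<alpha>\<^sup>2" "v\<^sup>2 \<le> \<alpha>\<^sup>2" "\<alpha>\<^sup>2 \<le> 1" "u - v \<le> m / (2 * n)"
  shows "(1 + (1 - \<alpha>\<^sup>2) * l\<^sup>2 / (2 * n)) * exp (- (l * m / sqrt (n - 1)))
    \<le> ((1 + u) * (1 + v) * e m + (1 + u) * (1 - v) * e (m + 2)
       + (1 - u) * (1 + v) * e (m - 2) + (1 - u) * (1 - v) * e m) / 4"
proof -
  \<comment> \<open>Unit step and shift by renormalisation: \<open>l\<close> times the normalised
    gap changes by \<open>z\<close>, \<open>z + 2 s\<close> or \<open>z - 2 s\<close>.\<close>
  define s z where "s = l / sqrt n" and "z = l * m / sqrt n - l * m / sqrt (n - 1)"
  define E where "E = exp (- (l * m / sqrt (n - 1)))"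
  define g where "g y = 1 - y + y\<^sup>2 / 4" for y :: real
  have s: "0 \<le> s" "s \<le> 1" using l n by (auto simp: s_def)
  have drift: "(1 + 1 / (2 * n)) / sqrt n \<le> 1 / sqrt (n - 1)"
    by (rule inverse_sqrt_drift[OF n])
  have "l * (m / sqrt n) \<le> l * (m / sqrt (n - 1))"
    using n m l by (intro mult_left_mono divide_left_mono) auto
  then have z: "z \<le> 0" by (simp add: z_def)
  have uv1: "\<bar>u\<bar> \<le> 1" "\<bar>v\<bar> \<le> 1" using uv by (auto simp: abs_square_le_1[symmetric])
  have eE: "e m = E * exp (- z)" "e (m + 2) = E * exp (- (z + 2 * s))" "e (m - 2) = E * exp (- (z - 2 * s))"
    unfolding e_def E_def z_def s_def
    by (simp_all add: add_divide_distrib diff_divide_distrib ring_distribs flip: exp_add)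
  have "z + s * (u - v) \<le> l * m / sqrt n - l * m / sqrt (n - 1) + s * (m / (2 * n))"
    unfolding z_def using s uv by (intro add_left_mono mult_left_mono)
  also have "\<dots> = l * m * ((1 + 1 / (2 * n)) / sqrt n - 1 / sqrt (n - 1))"
    by (simp add: s_def algebra_simps add_divide_distrib)
  also have "\<dots> \<le> 0"
    using drift l m by (intro mult_nonneg_nonpos) auto
  finally have mean: "z + s * (u - v) \<le> 0" .
  have "1 + (1 - \<alpha>\<^sup>2) * l\<^sup>2 / (2 * n) = 1 + s\<^sup>2 * (2 - \<alpha>\<^sup>2 - \<alpha>\<^sup>2) / 4"
    using n by (simp add: s_def power_divide field_simps)
  also have "\<dots> \<le> 1 + s\<^sup>2 * (2 - u\<^sup>2 - v\<^sup>2) / 4"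
    using uv by (intro add_left_mono divide_right_mono mult_left_mono) auto
  also have "\<dots> \<le> 1 - (z + s * (u - v)) + (z + s * (u - v))\<^sup>2 / 4 + s\<^sup>2 * (2 - u\<^sup>2 - v\<^sup>2) / 4"
  proof -
    have "0 \<le> (z + s * (u - v))\<^sup>2 / 4" by simp
    then show ?thesis using mean by linarith
  qed
  \<comment> \<open>The increment has mean \<open>z + s (u - v)\<close> and variance
    \<open>s\<^sup>2 (2 - u\<^sup>2 - v\<^sup>2)\<close>; as \<open>g\<close> is quadratic, its mean
    depends on these two alone.\<close>
  also have "\<dots> = ((1 + u) * (1 + v) * g z + (1 + u) * (1 - v) * g (z + 2 * s)
       + (1 - u) * (1 + v) * g (z - 2 * s) + (1 - u) * (1 - v) * g z) / 4"
  proof -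
    have "4 * (4 - 4 * (z + s * (u - v)) + (z + s * (u - v))\<^sup>2 + s\<^sup>2 * (2 - u\<^sup>2 - v\<^sup>2))
      = (1 + u) * (1 + v) * (4 - 4 * z + z\<^sup>2) + (1 + u) * (1 - v) * (4 - 4 * (z + 2 * s) + (z + 2 * s)\<^sup>2)
       + (1 - u) * (1 + v) * (4 - 4 * (z - 2 * s) + (z - 2 * s)\<^sup>2) + (1 - u) * (1 - v) * (4 - 4 * z + z\<^sup>2)"
      by algebra
    moreover have "g y = (4 - 4 * y + y\<^sup>2) / 4" for y by (simp add: g_def)
    ultimately show ?thesis by (simp only: times_divide_eq_right add_divide_distrib[symmetric]) simp
  qed
  \<comment> \<open>From \<open>l \<le> sqrt n\<close> follows \<open>s \<le> 1\<close>, so all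
    increments are at most 2, as \<open>exp_neg_ge\<close> requires.\<close>
  also have "\<dots> \<le> ((1 + u) * (1 + v) * exp (- z) + (1 + u) * (1 - v) * exp (- (z + 2 * s))
       + (1 - u) * (1 + v) * exp (- (z - 2 * s)) + (1 - u) * (1 - v) * exp (- z)) / 4"
    unfolding g_def using s z uv1
    by (intro divide_right_mono add_mono mult_left_mono exp_neg_ge mult_nonneg_nonneg) auto
  finally have "E * (1 + (1 - \<alpha>\<^sup>2) * l\<^sup>2 / (2 * n)) \<le> E * \<dots>"
    by (intro mult_left_mono) (auto simp: E_def)
  then show ?thesis
    unfolding eE E_def[symmetric] by (simp add: algebra_simps)
qed

text \<open>An even nonzero difference is at least 2 in absolute value, so a change by 2 cannot
  reverse the order of the walks. The gap itself then moves by -2, 0 or 2, where \<open>u\<close> is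
  the mean step of the walk ahead and \<open>v\<close> that of the walk behind.\<close>

lemma pair_step_abs_diff:
  fixes a b :: int and p :: real
  assumes p: "0 \<le> p" "p \<le> 1" and n: "1 \<le> n" and ab: "\<bar>a\<bar> \<le> int n" "\<bar>b\<bar> \<le> int n" "a \<noteq> b" "even (a - b)"
  obtains u v :: real where
    "\<And>k. pair_step p n (\<lambda>a b. k (real_of_int \<bar>a - b\<bar>)) a b =
      ((1 + u) * (1 + v) * k (real_of_int \<bar>a - b\<bar>) + (1 + u) * (1 - v) * k (real_of_int \<bar>a - b\<bar> + 2)
       + (1 - u) * (1 + v) * k (real_of_int \<bar>a - b\<bar> - 2) + (1 - u) * (1 - v) * k (real_of_int \<bar>a - b\<bar>)) / 4"
    "u\<^sup>2 \<le> (2 * p - 1)\<^sup>2" "v\<^sup>2 \<le> (2 * p - 1)\<^sup>2" "u - v = (2 * p - 1) * \<bar>a - b\<bar> / n"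
    "2 \<le> \<bar>a - b\<bar>"
proof -
  let ?r = "\<lambda>c::int. (2 * p - 1) * c / n"
  have r: "(?r c)\<^sup>2 \<le> (2 * p - 1)\<^sup>2" if "\<bar>c\<bar> \<le> int n" for c
  proof -
    have "\<bar>real_of_int c / n\<bar> \<le> 1" using that n by (simp add: divide_le_eq)
    then have "(real_of_int c / n)\<^sup>2 \<le> 1" by (simp add: abs_square_le_1)
    then have "(2 * p - 1)\<^sup>2 * (real_of_int c / n)\<^sup>2 \<le> (2 * p - 1)\<^sup>2 * 1"
      by (intro mult_left_mono) auto
    then show ?thesis by (simp add: power_mult_distrib power_divide)
  qed
  have 2: "2 \<le> \<bar>a - b\<bar>" using ab(3,4) by presburger
  define \<mu> \<nu> where "\<mu> = ?r a" and "\<nu> = ?r b"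
  have \<mu>\<nu>: "\<mu> - \<nu> = (2 * p - 1) * (real_of_int a - real_of_int b) / n"
    by (simp add: \<mu>_def \<nu>_def right_diff_distrib diff_divide_distrib)
  show ?thesis
  proof (cases "a > b")
    case True
    then have "real_of_int \<bar>a + 1 - (b + 1)\<bar> = real_of_int \<bar>a - b\<bar>"
      "real_of_int \<bar>a + 1 - (b - 1)\<bar> = real_of_int \<bar>a - b\<bar> + 2"
      "real_of_int \<bar>a - 1 - (b + 1)\<bar> = real_of_int \<bar>a - b\<bar> - 2"
      "real_of_int \<bar>a - 1 - (b - 1)\<bar> = real_of_int \<bar>a - b\<bar>" using 2 by auto
    note k = this
    show ?thesis
    proof (rule that[of \<mu> \<nu>])
      show "\<mu> - \<nu> = (2 * p - 1) * \<bar>a - b\<bar> / n" using True \<mu>\<nu> by simp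
    qed (unfold pair_step_expand k \<mu>_def[symmetric] \<nu>_def[symmetric],
        use r ab 2 in \<open>auto simp: \<mu>_def \<nu>_def\<close>)
  next
    case False
    then have "real_of_int \<bar>a + 1 - (b + 1)\<bar> = real_of_int \<bar>a - b\<bar>"
      "real_of_int \<bar>a + 1 - (b - 1)\<bar> = real_of_int \<bar>a - b\<bar> - 2"
      "real_of_int \<bar>a - 1 - (b + 1)\<bar> = real_of_int \<bar>a - b\<bar> + 2"
      "real_of_int \<bar>a - 1 - (b - 1)\<bar> = real_of_int \<bar>a - b\<bar>" using 2 by auto
    note k = this
    show ?thesis
    proof (rule that[of \<nu> \<mu>])
      have "\<nu> - \<mu> = - (\<mu> - \<nu>)" by simp
      also have "\<dots> = (2 * p - 1) * \<bar>a - b\<bar> / n"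
        unfolding \<mu>\<nu> minus_divide_left mult_minus_right[symmetric] using False by simp
      finally show "\<nu> - \<mu> = (2 * p - 1) * \<bar>a - b\<bar> / n" .
      show "pair_step p n (\<lambda>a b. k (real_of_int \<bar>a - b\<bar>)) a b =
        ((1 + \<nu>) * (1 + \<mu>) * k (real_of_int \<bar>a - b\<bar>) + (1 + \<nu>) * (1 - \<mu>) * k (real_of_int \<bar>a - b\<bar> + 2)
         + (1 - \<nu>) * (1 + \<mu>) * k (real_of_int \<bar>a - b\<bar> - 2) + (1 - \<nu>) * (1 - \<mu>) * k (real_of_int \<bar>a - b\<bar>)) / 4" for k
        unfolding pair_step_expand k \<mu>_def[symmetric] \<nu>_def[symmetric] by (simp add: mult_ac add_ac)
    qed (use r ab 2 in \<open>auto simp: \<mu>_def \<nu>_def\<close>)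
  qed
qed

text \<open>For \<open>p \<le> 3/4\<close> the gap grows in mean by at most itself over
  \<open>2 n\<close>, which \<open>inverse_sqrt_drift\<close> absorbs.\<close>

lemma pair_step_sqrt_supermartingale:
  assumes p: "0 \<le> p" "p \<le> 3/4" and n: "2 \<le> n" and ab: "\<bar>a\<bar> \<le> int n" "\<bar>b\<bar> \<le> int n" "a \<noteq> b" "even (a - b)"
  shows "pair_step p n (\<lambda>a b. real_of_int \<bar>a - b\<bar> / sqrt n) a b \<le> real_of_int \<bar>a - b\<bar> / sqrt (real n - 1)"
proof -
  have p1: "p \<le> 1" "1 \<le> n" using p n by auto
  obtain u v where uv: "\<And>k. pair_step p n (\<lambda>a b. k (real_of_int \<bar>a - b\<bar>)) a b =
      ((1 + u) * (1 + v) * k (real_of_int \<bar>a - b\<bar>) + (1 + u) * (1 - v) * k (real_of_int \<bar>a - b\<bar> + 2)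
       + (1 - u) * (1 + v) * k (real_of_int \<bar>a - b\<bar> - 2) + (1 - u) * (1 - v) * k (real_of_int \<bar>a - b\<bar>)) / 4"
    "u\<^sup>2 \<le> (2 * p - 1)\<^sup>2" "v\<^sup>2 \<le> (2 * p - 1)\<^sup>2" "u - v = (2 * p - 1) * \<bar>a - b\<bar> / n"
    "2 \<le> \<bar>a - b\<bar>"
    by (rule pair_step_abs_diff[OF p(1) p1 ab]) (rule that)
  define m where "m = real_of_int \<bar>a - b\<bar>"
  have m0: "0 \<le> m" by (simp add: m_def)
  have "pair_step p n (\<lambda>a b. real_of_int \<bar>a - b\<bar> / sqrt n) a b = (m + (u - v)) / sqrt n"
  proof -
    define i where "i = 1 / sqrt n"
    have i: "t / sqrt n = t * i" for t by (simp add: i_def)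
    show ?thesis
      unfolding i uv(1)[of "\<lambda>t. t * i"] m_def[symmetric] by (simp add: field_simps)
  qed
  also have "\<dots> \<le> (m + m / (2 * real n)) / sqrt n"
  proof -
    have "(2 * p - 1) * m / n \<le> (1 / 2) * m / n"
      using p m0 by (intro divide_right_mono mult_right_mono) auto
    then show ?thesis unfolding uv(4) m_def[symmetric] by (intro divide_right_mono) auto
  qed
  also have "\<dots> = m * ((1 + 1 / (2 * real n)) / sqrt n)" by (simp add: field_simps)
  also have "\<dots> \<le> m * (1 / sqrt (real n - 1))"
    using n m0 by (intro mult_left_mono inverse_sqrt_drift) auto
  finally show ?thesis by (simp add: m_def)
qed

text \<open>This is \<open>exp_weighted_ge\<close> with \<open>\<alpha> = 2 p - 1\<close>, where
  \<open>1 - \<alpha>\<^sup>2 = 4 p (1 - p)\<close>. The loss coefficient decays only like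
  \<open>1 / n\<close>, slowly enough for its sum to diverge.\<close>

lemma pair_step_exp_supermartingale:
  assumes p: "0 \<le> p" "p \<le> 3/4" and n: "2 \<le> n" and ab: "\<bar>a\<bar> \<le> int n" "\<bar>b\<bar> \<le> int n" "a \<noteq> b" "even (a - b)"
    and l: "0 \<le> l" "l \<le> sqrt n"
  shows "pair_step p n (\<lambda>a b. 1 - exp (- (l * real_of_int \<bar>a - b\<bar> / sqrt n))) a b
    \<le> 1 - (1 + 2 * p * (1 - p) * l\<^sup>2 / n) * exp (- (l * real_of_int \<bar>a - b\<bar> / sqrt (real n - 1)))"
proof -
  have p1: "p \<le> 1" "1 \<le> n" using p n by auto
  obtain u v where uv: "\<And>k. pair_step p n (\<lambda>a b. k (real_of_int \<bar>a - b\<bar>)) a b =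
      ((1 + u) * (1 + v) * k (real_of_int \<bar>a - b\<bar>) + (1 + u) * (1 - v) * k (real_of_int \<bar>a - b\<bar> + 2)
       + (1 - u) * (1 + v) * k (real_of_int \<bar>a - b\<bar> - 2) + (1 - u) * (1 - v) * k (real_of_int \<bar>a - b\<bar>)) / 4"
    "u\<^sup>2 \<le> (2 * p - 1)\<^sup>2" "v\<^sup>2 \<le> (2 * p - 1)\<^sup>2" "u - v = (2 * p - 1) * \<bar>a - b\<bar> / n"
    "2 \<le> \<bar>a - b\<bar>"
    by (rule pair_step_abs_diff[OF p(1) p1 ab]) (rule that)
  define m where "m = real_of_int \<bar>a - b\<bar>"
  have m2: "2 \<le> m" using uv(5) by (simp add: m_def)
  have "(2 * p - 1) * m / n \<le> (1 / 2) * m / n"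
    using p m2 by (intro divide_right_mono mult_right_mono) auto
  then have drift: "u - v \<le> m / (2 * real n)" by (simp add: uv(4) m_def)
  have "\<bar>2 * p - 1\<bar> \<le> 1" using p by auto
  then have \<alpha>: "(2 * p - 1)\<^sup>2 \<le> 1" by (simp add: abs_square_le_1)
  define e where "e t = exp (- (l * t / sqrt n))" for t
  have "(1 + (1 - (2 * p - 1)\<^sup>2) * l\<^sup>2 / (2 * real n)) * exp (- (l * m / sqrt (real n - 1)))
    \<le> ((1 + u) * (1 + v) * e m + (1 + u) * (1 - v) * e (m + 2)
       + (1 - u) * (1 + v) * e (m - 2) + (1 - u) * (1 - v) * e m) / 4"
    unfolding e_def using n by (intro exp_weighted_ge m2 l uv drift \<alpha>) auto
  moreover have "(1 - (2 * p - 1)\<^sup>2) * l\<^sup>2 / (2 * real n) = 2 * p * (1 - p) * l\<^sup>2 / n"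
    using n by (simp add: power2_eq_square field_simps)
  moreover have "pair_step p n (\<lambda>a b. 1 - exp (- (l * real_of_int \<bar>a - b\<bar> / sqrt n))) a b
    = 1 - ((1 + u) * (1 + v) * e m + (1 + u) * (1 - v) * e (m + 2)
       + (1 - u) * (1 + v) * e (m - 2) + (1 - u) * (1 - v) * e m) / 4"
    unfolding e_def[symmetric] uv(1)[of "\<lambda>t. 1 - e t"] m_def[symmetric]
    by (simp add: field_simps)
  ultimately show ?thesis by (simp add: m_def)
qed

section \<open>Contraction of the reciprocal for p above 3/4\<close>

lemma reciprocal_taylor_le:
  fixes V \<Delta> C :: real
  assumes "V > 0" "V + \<Delta> \<ge> V / 2" "\<Delta>\<^sup>2 \<le> C / 2"
  shows "1 / (V + \<Delta>) \<le> 1 / V - \<Delta> / V\<^sup>2 + C / V ^ 3"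
proof -
  have pos: "V + \<Delta> > 0" using assms by linarith
  \<comment> \<open>Exact remainder of the first-order expansion; the last two hypotheses bound it
    by \<open>C / V ^ 3\<close>.\<close>
  have "1 / (V + \<Delta>) = 1 / V - \<Delta> / V\<^sup>2 + \<Delta>\<^sup>2 / (V + \<Delta>) / V\<^sup>2"
    using assms(1) pos by (simp add: divide_simps power2_eq_square) algebra
  also have "\<Delta>\<^sup>2 / (V + \<Delta>) \<le> (C / 2) / (V / 2)"
    using assms order_trans[OF zero_le_power2 assms(3)] by (intro frac_le) auto
  then have "\<Delta>\<^sup>2 / (V + \<Delta>) / V\<^sup>2 \<le> (C / 2) / (V / 2) / V\<^sup>2"
    by (intro divide_right_mono) auto
  also have "(C / 2) / (V / 2) / V\<^sup>2 = C / V ^ 3"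
    by (simp add: power2_eq_square power3_eq_cube)
  finally show ?thesis by simp
qed

text \<open>A move \<open>t\<close> of the difference changes \<open>V\<close> by
  \<open>B + 2 d t + t\<^sup>2\<close>, and \<open>t\<close> has mean \<open>u - v\<close> and
  second moment \<open>2 (1 - u v)\<close>. \<open>C\<close> is twice a bound on the square of this
  change; \<open>B \<ge> 4\<close> keeps the new value at least \<open>V / 2\<close>.\<close>

lemma weighted_reciprocal_le:
  fixes d n B u v :: real
  defines "V \<equiv> B * n + d\<^sup>2" and "C \<equiv> 4 * (B + 4)\<^sup>2 + 64 * d\<^sup>2"
    and "k \<equiv> \<lambda>t. 1 / (B * (n + 1) + (d + t)\<^sup>2)"
  assumes B: "B \<ge> 4" and n: "n \<ge> 1" and uv: "\<bar>u\<bar> \<le> 1" "\<bar>v\<bar> \<le> 1"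
  shows "((1 + u) * (1 + v) * k 0 + (1 + u) * (1 - v) * k 2
       + (1 - u) * (1 + v) * k (-2) + (1 - u) * (1 - v) * k 0) / 4
    \<le> (1 / V) * (1 - (B + 2 * d * (u - v) + 2 * (1 - u * v)) / V + C / V\<^sup>2)"
proof -
  have "B * n > 0" using B n by simp
  then have V: "V > 0" by (simp add: V_def add_pos_nonneg)
  define g where "g t = 1 / V - (B + 2 * d * t + t\<^sup>2) / V\<^sup>2 + C / V ^ 3" for t
  have kg: "k t \<le> g t" if t: "\<bar>t\<bar> \<le> 2" for t
  proof -
    have t2: "t\<^sup>2 \<le> 4" using power_mono[OF t abs_ge_zero, of 2] by simp
    have "0 \<le> (d + 2 * t)\<^sup>2" by simp
    then have "(d + t)\<^sup>2 \<ge> d\<^sup>2 / 2 - t\<^sup>2" by (simp add: power2_eq_square algebra_simps)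
    then have "V + (B + 2 * d * t + t\<^sup>2) \<ge> V / 2"
      using t2 B \<open>B * n > 0\<close> by (simp add: V_def power2_eq_square algebra_simps)
    moreover have "(B + 2 * d * t + t\<^sup>2)\<^sup>2 \<le> C / 2"
    proof -
      have "\<bar>d * t\<bar> \<le> \<bar>d\<bar> * 2" unfolding abs_mult using t by (intro mult_left_mono) auto
      then have "\<bar>B + 2 * d * t + t\<^sup>2\<bar> \<le> (B + 4) + 4 * \<bar>d\<bar>"
        using t2 B zero_le_power2[of t] unfolding mult.assoc by linarith
      then have "(B + 2 * d * t + t\<^sup>2)\<^sup>2 \<le> ((B + 4) + 4 * \<bar>d\<bar>)\<^sup>2"
        using power_mono[of "\<bar>B + 2 * d * t + t\<^sup>2\<bar>" "(B + 4) + 4 * \<bar>d\<bar>" 2] by simp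
      also have "\<dots> \<le> 2 * (B + 4)\<^sup>2 + 2 * (4 * \<bar>d\<bar>)\<^sup>2"
        using sum_squares_bound[of "B + 4" "4 * \<bar>d\<bar>"] unfolding power2_sum[of "B + 4" "4 * \<bar>d\<bar>"] by linarith
      also have "\<dots> = C / 2" by (simp add: C_def power_mult_distrib)
      finally show ?thesis .
    qed
    ultimately have "1 / (V + (B + 2 * d * t + t\<^sup>2)) \<le> g t"
      unfolding g_def using V by (intro reciprocal_taylor_le) auto
    moreover have "V + (B + 2 * d * t + t\<^sup>2) = B * (n + 1) + (d + t)\<^sup>2"
      by (simp add: V_def power2_eq_square algebra_simps)
    ultimately show ?thesis by (simp add: k_def)
  qed
  have "((1 + u) * (1 + v) * k 0 + (1 + u) * (1 - v) * k 2
       + (1 - u) * (1 + v) * k (-2) + (1 - u) * (1 - v) * k 0) / 4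
    \<le> ((1 + u) * (1 + v) * g 0 + (1 + u) * (1 - v) * g 2
       + (1 - u) * (1 + v) * g (-2) + (1 - u) * (1 - v) * g 0) / 4"
    using uv by (intro divide_right_mono add_mono mult_left_mono kg mult_nonneg_nonneg) auto
  also have "\<dots> = 1 / V - (B + 2 * d * (u - v) + 2 * (1 - u * v)) / V\<^sup>2 + C / V ^ 3"
  proof -
    define a b where "a = 1 / V + C / V ^ 3" and "b = 1 / V\<^sup>2"
    have g: "g t = a - (B + 2 * d * t + t\<^sup>2) * b" for t by (simp add: g_def a_def b_def)
    have "((1 + u) * (1 + v) * g 0 + (1 + u) * (1 - v) * g 2
       + (1 - u) * (1 + v) * g (-2) + (1 - u) * (1 - v) * g 0) / 4
      = a - (B + 2 * d * (u - v) + 2 * (1 - u * v)) * b"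
      unfolding g by (simp add: field_simps)
    then show ?thesis by (simp add: a_def b_def)
  qed
  also have "\<dots> = (1 / V) * (1 - (B + 2 * d * (u - v) + 2 * (1 - u * v)) / V + C / V\<^sup>2)"
    using V by (simp add: field_simps power2_eq_square power3_eq_cube)
  finally show ?thesis .
qed

text \<open>The quotient contracts once its denominator grows in mean at a relative rate above
  \<open>1 / n\<close>. For \<open>p > 3/4\<close> the drift of the squared difference is
  \<open>2 (2 p - 1) > 1\<close> times its value over \<open>n\<close>; when the difference is
  small, the step variance does the work.\<close>

lemma pair_step_reciprocal_contraction:
  fixes p :: real
  assumes p: "3/4 < p" "p < 1"
  obtains B \<rho> :: real and n0 :: nat where "B > 0" "\<rho> > 0" "n0 \<ge> 1"
    "\<And>n a b. n \<ge> n0 \<Longrightarrow> \<bar>a\<bar> \<le> int n \<Longrightarrow> \<bar>b\<bar> \<le> int n \<Longrightarrow>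
      pair_step p n (\<lambda>a b. real (Suc n) / (B * real (Suc n) + (real_of_int (a - b))\<^sup>2)) a b
      \<le> (1 - \<rho> / n) * (n / (B * n + (real_of_int (a - b))\<^sup>2))"
proof -
  \<comment> \<open>\<open>1 + 2 \<gamma>\<close> is \<open>2 (2 p - 1)\<close>, and
    \<open>\<kappa>\<close> bounds \<open>1 - u v\<close> from below. \<open>B\<close> makes the
    \<open>d\<^sup>2\<close> part of \<open>C / V\<close> at most
    \<open>\<gamma> d\<^sup>2 / n\<close>, \<open>n0\<close> makes the rest at most
    \<open>\<kappa>\<close>, and \<open>\<rho>\<close> satisfies
    \<open>\<rho> V \<le> \<kappa> n + \<gamma> d\<^sup>2\<close>.\<close>
  define \<gamma> \<kappa> where "\<gamma> = (4 * p - 3) / 2" and "\<kappa> = 1 - (2 * p - 1)\<^sup>2"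
  define B where "B = 64 / \<gamma>"
  define \<rho> where "\<rho> = min (\<kappa> / B) \<gamma>"
  define n0 where "n0 = Suc (nat \<lceil>4 * (B + 4)\<^sup>2 / (B * \<kappa>)\<rceil>)"
  have \<gamma>: "0 < \<gamma>" "\<gamma> \<le> 1" using p by (auto simp: \<gamma>_def)
  have \<kappa>: "\<kappa> > 0" using p by (simp add: \<kappa>_def abs_square_less_1)
  have B: "B \<ge> 64" using \<gamma> by (simp add: B_def le_divide_eq)
  have \<rho>: "\<rho> > 0" using \<gamma> \<kappa> B by (simp add: \<rho>_def)
  have "pair_step p n (\<lambda>a b. real (Suc n) / (B * real (Suc n) + (real_of_int (a - b))\<^sup>2)) a b
      \<le> (1 - \<rho> / n) * (n / (B * n + (real_of_int (a - b))\<^sup>2))"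
    if n: "n \<ge> n0" and ab: "\<bar>a\<bar> \<le> int n" "\<bar>b\<bar> \<le> int n" for n a b
  proof -
    define d x where "d = real_of_int (a - b)" and "x = real n"
    define u v where "u = (2 * p - 1) * a / n" and "v = (2 * p - 1) * b / n"
    define V where "V = B * x + d\<^sup>2"
    define C where "C = 4 * (B + 4)\<^sup>2 + 64 * d\<^sup>2"
    define k where "k t = 1 / (B * (x + 1) + (d + t)\<^sup>2)" for t
    have x: "x \<ge> 1" using n by (simp add: x_def n0_def)
    have x0: "4 * (B + 4)\<^sup>2 / (B * \<kappa>) \<le> x"
      using n unfolding x_def n0_def by linarith
    have "B * x > 0" using B x by simp
    then have V: "V > 0" "V \<ge> B * x" by (simp_all add: V_def add_pos_nonneg)
    have bnd: "\<bar>(2 * p - 1) * c / n\<bar> \<le> 2 * p - 1" if "\<bar>c\<bar> \<le> int n" for c :: int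
    proof -
      have "(2 * p - 1) * (\<bar>real_of_int c\<bar> / n) \<le> (2 * p - 1) * 1"
        using that x p by (intro mult_left_mono) (auto simp: divide_le_eq x_def)
      then show ?thesis using p by (simp add: abs_mult)
    qed
    have uv: "\<bar>u\<bar> \<le> 2 * p - 1" "\<bar>v\<bar> \<le> 2 * p - 1" using bnd ab by (auto simp: u_def v_def)
    have "\<bar>u\<bar> * \<bar>v\<bar> \<le> (2 * p - 1) * (2 * p - 1)" using uv p by (intro mult_mono) auto
    then have "\<bar>u * v\<bar> \<le> (2 * p - 1)\<^sup>2" by (simp add: abs_mult power2_eq_square)
    then have var: "1 - u * v \<ge> \<kappa>" unfolding \<kappa>_def by linarith
    have drift: "2 * d * (u - v) = (1 + 2 * \<gamma>) * d\<^sup>2 / x"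
    proof -
      have "u - v = (2 * p - 1) * d / x"
        by (simp add: u_def v_def d_def x_def right_diff_distrib diff_divide_distrib)
      moreover have "1 + 2 * \<gamma> = 2 * (2 * p - 1)" by (simp add: \<gamma>_def field_simps)
      ultimately show ?thesis by (simp add: power2_eq_square)
    qed
    define A where "A = B + 2 * d * (u - v) + 2 * (1 - u * v)"
    have "pair_step p n (\<lambda>a b. real (Suc n) / (B * real (Suc n) + (real_of_int (a - b))\<^sup>2)) a b
      = (x + 1) * (((1 + u) * (1 + v) * k 0 + (1 + u) * (1 - v) * k 2
       + (1 - u) * (1 + v) * k (-2) + (1 - u) * (1 - v) * k 0) / 4)"
    proof -
      have 1: "real_of_int (a + 1 - (b + 1)) = d" "real_of_int (a - 1 - (b - 1)) = d"
        "real_of_int (a + 1 - (b - 1)) = d + 2" "real_of_int (a - 1 - (b + 1)) = d + -2" "real (Suc n) = x + 1"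
        by (auto simp: d_def x_def)
      have 2: "(x + 1) / (B * (x + 1) + (d + t)\<^sup>2) = (x + 1) * k t" for t by (simp add: k_def)
      have 3: "(x + 1) / (B * (x + 1) + d\<^sup>2) = (x + 1) * k 0" by (simp add: k_def)
      show ?thesis
        unfolding pair_step_expand u_def[symmetric] v_def[symmetric] 1 2 3 by (simp add: algebra_simps)
    qed
    also have "\<dots> \<le> (x + 1) * ((1 / V) * (1 - A / V + C / V\<^sup>2))"
      unfolding V_def C_def k_def A_def using B x uv p
      by (intro mult_left_mono weighted_reciprocal_le) auto
    \<comment> \<open>The growth \<open>A\<close> of \<open>V\<close> exceeds \<open>V / x\<close>
      by at least \<open>2 (\<kappa> + \<gamma> d\<^sup>2 / x)\<close>: one half pays for the error
      \<open>C / V\<close>, the other for \<open>\<rho>\<close>.\<close>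
    also have "1 - A / V + C / V\<^sup>2 \<le> 1 - (1 + \<rho>) / x"
    proof -
      have "C / V \<le> C / (B * x)"
        using V \<open>B * x > 0\<close> by (intro divide_left_mono) (auto simp: C_def)
      also have "\<dots> = 4 * (B + 4)\<^sup>2 / (B * x) + (64 / B) * d\<^sup>2 / x"
        by (simp add: C_def add_divide_distrib)
      also have "64 / B = \<gamma>" using \<gamma> by (simp add: B_def)
      also have "4 * (B + 4)\<^sup>2 / (B * x) \<le> \<kappa>"
        using x0 x B \<kappa> by (simp add: field_simps)
      finally have C: "C / V \<le> \<kappa> + \<gamma> * d\<^sup>2 / x" by simp
      have "\<rho> * V \<le> \<kappa> * x + \<gamma> * d\<^sup>2"
      proof -
        have "\<rho> \<le> \<kappa> / B" "\<rho> \<le> \<gamma>" by (simp_all add: \<rho>_def)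
        then have "\<rho> * (B * x) \<le> (\<kappa> / B) * (B * x)" "\<rho> * d\<^sup>2 \<le> \<gamma> * d\<^sup>2"
          using \<open>B * x > 0\<close> by (intro mult_right_mono; simp)+
        then show ?thesis using B by (simp add: V_def algebra_simps)
      qed
      then have "(1 + \<rho>) * V / x \<le> (B * x + d\<^sup>2 + \<kappa> * x + \<gamma> * d\<^sup>2) / x"
        using x by (intro divide_right_mono) (auto simp: V_def algebra_simps)
      also have "\<dots> = B + (1 + 2 * \<gamma>) * d\<^sup>2 / x + 2 * \<kappa> - (\<kappa> + \<gamma> * d\<^sup>2 / x)"
        using x by (simp add: field_simps)
      also have "\<dots> \<le> A - C / V"
        unfolding A_def drift by (intro diff_mono add_mono mult_left_mono order_refl C var) simp
      finally have "((1 + \<rho>) * V / x) / V \<le> (A - C / V) / V"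
        using V by (intro divide_right_mono) auto
      then have "(1 + \<rho>) / x \<le> A / V - C / V\<^sup>2"
        using V by (simp add: diff_divide_distrib power2_eq_square)
      then show ?thesis by simp
    qed
    then have "(x + 1) * ((1 / V) * (1 - A / V + C / V\<^sup>2)) \<le> (x + 1) * ((1 / V) * (1 - (1 + \<rho>) / x))"
      using x V by (intro mult_left_mono) auto
    also have "\<dots> = (1 / V) * ((x + 1) * (1 - (1 + \<rho>) / x))" by simp
    also have "\<dots> \<le> (1 / V) * ((1 - \<rho> / x) * x)"
    proof (intro mult_left_mono)
      \<comment> \<open>The increase of the numerator from \<open>x\<close> to \<open>x + 1\<close>
        uses up the 1 in \<open>1 + \<rho>\<close>.\<close>
      have "(x + 1) * (1 - (1 + \<rho>) / x) = (1 - \<rho> / x) * x - (1 + \<rho>) / x"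
        using x by (simp add: field_simps)
      then show "(x + 1) * (1 - (1 + \<rho>) / x) \<le> (1 - \<rho> / x) * x"
        using x \<rho> by simp
    qed (use V in auto)
    finally show ?thesis by (simp add: V_def x_def d_def mult_ac)
  qed
  then show ?thesis using B \<rho> by (intro that[of B \<rho> n0]) (auto simp: n0_def)
qed

section \<open>Meeting probabilities\<close>

definition separated :: "nat \<Rightarrow> nat \<Rightarrow> (erw_idx \<Rightarrow> int) \<Rightarrow> bool" where
  "separated N n f \<longleftrightarrow> (\<forall>k\<in>{N..n}. erw_S f True k \<noteq> erw_S f False k)"

lemma separated_cong:
  assumes "1 \<le> n" "\<And>i. i \<in> hist_indices n \<Longrightarrow> f i = g i"
  shows "separated N n f = separated N n g"
proof -
  have "erw_S f w k = erw_S g w k" if "k \<le> n" for w k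
    using assms that by (intro erw_S_cong[where n = n]) auto
  then show ?thesis by (simp add: separated_def)
qed

lemma separated_Suc:
  "N \<le> Suc n \<Longrightarrow> separated N (Suc n) f \<longleftrightarrow> separated N n f \<and> erw_S f True (Suc n) \<noteq> erw_S f False (Suc n)"
  by (auto simp: separated_def le_Suc_eq)

lemma separated_regularD:
  assumes "separated N n f" "regular n f" "N \<le> n"
  shows "erw_S f True n \<noteq> erw_S f False n" "even (erw_S f True n - erw_S f False n)"
    "\<bar>erw_S f True n\<bar> \<le> int n" "\<bar>erw_S f False n\<bar> \<le> int n"
proof -
  show "erw_S f True n \<noteq> erw_S f False n" using assms by (auto simp: separated_def)
  show "even (erw_S f True n - erw_S f False n)"
    using erw_S_regular(2)[OF assms(2), of True] erw_S_regular(2)[OF assms(2), of False] by simp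
qed (use erw_S_regular(1)[OF assms(2)] in auto)

text \<open>As \<open>u\<close> vanishes at meetings, the indicator up to \<open>n + 1\<close> may
  be replaced by the one up to \<open>n\<close>, which depends on the past only. This plays the role
  of stopping at the first meeting.\<close>

lemma expectation_separated_step:
  assumes p: "0 \<le> p" "p \<le> 1" and n: "1 \<le> n" "N \<le> Suc n" and u: "\<And>a. u a a = 0"
  shows "measure_pmf.expectation (history_pmf p s (Suc n))
      (\<lambda>f. of_bool (separated N (Suc n) f) * u (erw_S f True (Suc n)) (erw_S f False (Suc n)))
    = measure_pmf.expectation (history_pmf p s n)
      (\<lambda>f. of_bool (separated N n f) * pair_step p n u (erw_S f True n) (erw_S f False n))"
proof -
  have eq: "of_bool (separated N (Suc n) f) * u (erw_S f True (Suc n)) (erw_S f False (Suc n))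
    = of_bool (separated N n f) * u (erw_S f True (Suc n)) (erw_S f False (Suc n))" for f
    using n(2) u by (auto simp: separated_Suc)
  show ?thesis
    unfolding eq
  proof (rule expectation_step[OF p n(1), where I = "\<lambda>f. of_bool (separated N n f)"])
    fix f g :: "erw_idx \<Rightarrow> int" assume "\<And>i. i \<in> hist_indices n \<Longrightarrow> f i = g i"
    then have "separated N n f = separated N n g" by (rule separated_cong[OF n(1)])
    then show "of_bool (separated N n f) = (of_bool (separated N n g) :: real)" by simp
  qed
qed

text \<open>Regular separated histories have distinct positions of equal parity within range, so the
  one-step inequality is demanded only there. That is where the gap cannot change sign.\<close>

lemma expectation_separated_mono:
  assumes p: "0 \<le> p" "p \<le> 1" and n: "1 \<le> n" "N \<le> n" and u: "\<And>a. u a a = 0"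
    and le: "\<And>a b. a \<noteq> b \<Longrightarrow> even (a - b) \<Longrightarrow> \<bar>a\<bar> \<le> int n \<Longrightarrow> \<bar>b\<bar> \<le> int n \<Longrightarrow> pair_step p n u a b \<le> v a b"
  shows "measure_pmf.expectation (history_pmf p s (Suc n))
      (\<lambda>f. of_bool (separated N (Suc n) f) * u (erw_S f True (Suc n)) (erw_S f False (Suc n)))
    \<le> measure_pmf.expectation (history_pmf p s n)
      (\<lambda>f. of_bool (separated N n f) * v (erw_S f True n) (erw_S f False n))"
  using n by (subst expectation_separated_step[OF p n(1) _ u])
    (auto intro!: expectation_history_mono le dest: separated_regularD)

abbreviation separation_prob :: "real \<Rightarrow> real \<Rightarrow> nat \<Rightarrow> nat \<Rightarrow> real" where
  "separation_prob p s N n \<equiv> measure_pmf.prob (history_pmf p s n) {f. separated N n f}"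

lemma separation_prob_eq:
  "separation_prob p s N n = measure_pmf.expectation (history_pmf p s n) (\<lambda>f. of_bool (separated N n f))"
proof -
  have "(\<lambda>f. of_bool (separated N n f)) = (indicator {f. separated N n f} :: _ \<Rightarrow> real)"
    by (auto simp: fun_eq_iff indicator_def)
  then show ?thesis by simp
qed

text \<open>The two probabilities belong to different product measures, so the step inequality,
  applied to the indicator of \<open>a \<noteq> b\<close>, replaces inclusion of events.\<close>

lemma separation_prob_Suc_le:
  assumes "0 \<le> p" "p \<le> 1" "1 \<le> n" "N \<le> n"
  shows "separation_prob p s N (Suc n) \<le> separation_prob p s N n"
proof -
  let ?u = "\<lambda>(a::int) b. if a = b then 0 else 1 :: real"
  have "pair_step p n ?u a b \<le> 1" if "\<bar>a\<bar> \<le> int n" "\<bar>b\<bar> \<le> int n" for a b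
    using pair_step_mono[of p a n b ?u "\<lambda>_ _. 1"] assms that by simp
  then have "measure_pmf.expectation (history_pmf p s (Suc n))
      (\<lambda>f. of_bool (separated N (Suc n) f) * ?u (erw_S f True (Suc n)) (erw_S f False (Suc n)))
    \<le> measure_pmf.expectation (history_pmf p s n) (\<lambda>f. of_bool (separated N n f) * 1)"
    by (intro expectation_separated_mono[OF assms]) auto
  moreover have "of_bool (separated N (Suc n) f) * (if erw_S f True (Suc n) = erw_S f False (Suc n) then 0 else 1)
    = (of_bool (separated N (Suc n) f) :: real)" for f
    using assms(4) by (auto simp: separated_Suc)
  ultimately show ?thesis by (simp add: separation_prob_eq)
qed

section \<open>Meetings recur for p at most 3/4\<close>

lemma separation_prob_tendsto_0:
  fixes p :: real
  assumes p: "0 < p" "p \<le> 3/4" and N: "2 \<le> N"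
  shows "separation_prob p s N \<longlonglongrightarrow> 0"
proof -
  let ?E = "\<lambda>n. measure_pmf.expectation (history_pmf p s n)"
  let ?D = "\<lambda>f n. real_of_int \<bar>erw_S f True n - erw_S f False n\<bar>"
  let ?P = "separation_prob p s N"
  define m where "m n = ?E n (\<lambda>f. of_bool (separated N n f) * (?D f n / sqrt (real n - 1)))" for n
  define Q where "Q l n = ?E n (\<lambda>f. of_bool (separated N n f) * (1 - exp (- (l * ?D f n / sqrt (real n - 1)))))" for l n
  have p': "0 \<le> p" "p \<le> 1" using p by auto
  have m_Suc: "m (Suc n) \<le> m n" if "N \<le> n" for n
    unfolding m_def
    using expectation_separated_mono[OF p' _ that, where s = s
      and u = "\<lambda>a b. real_of_int \<bar>a - b\<bar> / sqrt n" and v = "\<lambda>a b. real_of_int \<bar>a - b\<bar> / sqrt (real n - 1)"]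
      pair_step_sqrt_supermartingale[OF p'(1) p(2)] that N by simp
  have m_le: "m n \<le> m N" if "N \<le> n" for n
    using that by (induction rule: dec_induct) (auto intro: order_trans[OF m_Suc])
  have Q_le: "Q l n \<le> l * m n" if "l \<ge> 0" "N \<le> n" for l n
  proof -
    have "Q l n \<le> ?E n (\<lambda>f. l * (of_bool (separated N n f) * (?D f n / sqrt (real n - 1))))"
      unfolding Q_def
    proof (rule expectation_history_mono)
      fix f
      show "of_bool (separated N n f) * (1 - exp (- (l * ?D f n / sqrt (real n - 1))))
        \<le> l * (of_bool (separated N n f) * (?D f n / sqrt (real n - 1)))"
        using exp_ge_add_one_self[of "- (l * ?D f n / sqrt (real n - 1))"] by (auto simp: of_bool_def)
    qed
    then show ?thesis by (simp add: m_def)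
  qed
  have Q_nonneg: "0 \<le> Q l n" if "l \<ge> 0" "N \<le> n" for l n
    unfolding Q_def using that N by (intro Bochner_Integration.integral_nonneg) auto
  have m_nonneg: "0 \<le> m N"
    unfolding m_def using N by (intro Bochner_Integration.integral_nonneg) auto
  \<comment> \<open>\<open>?P n - Q l n\<close> is the mean of \<open>exp (- l M)\<close> over
    separated histories, and the loss is proportional to it.\<close>
  have Q_Suc: "Q l (Suc n) \<le> Q l n - 2 * p * (1 - p) * l\<^sup>2 / n * (?P n - Q l n)"
    if "N \<le> n" "l \<ge> 0" "l \<le> sqrt n" for l n
  proof -
    let ?c = "2 * p * (1 - p) * l\<^sup>2 / n"
    have "Q l (Suc n) \<le> ?E n (\<lambda>f. of_bool (separated N n f) *
        (1 - (1 + ?c) * exp (- (l * ?D f n / sqrt (real n - 1)))))"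
      unfolding Q_def
      using expectation_separated_mono[OF p' _ that(1), where s = s
        and u = "\<lambda>a b. 1 - exp (- (l * real_of_int \<bar>a - b\<bar> / sqrt n))"
        and v = "\<lambda>a b. 1 - (1 + ?c) * exp (- (l * real_of_int \<bar>a - b\<bar> / sqrt (real n - 1)))"]
      pair_step_exp_supermartingale[OF p'(1) p(2)] that N by simp
    also have "\<dots> = ?E n (\<lambda>f. (1 + ?c) * (of_bool (separated N n f) * (1 - exp (- (l * ?D f n / sqrt (real n - 1)))))
        - ?c * of_bool (separated N n f))"
      by (intro Bochner_Integration.integral_cong refl) (simp add: algebra_simps)
    also have "\<dots> = (1 + ?c) * Q l n - ?c * ?P n"
      unfolding Q_def separation_prob_eq by (subst Bochner_Integration.integral_diff) simp_all
    also have "\<dots> = Q l n - ?c * (?P n - Q l n)"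
    proof -
      have "(1 + c) * q - c * x = q - c * (x - q)" for c q x :: real by (simp add: algebra_simps)
      then show ?thesis .
    qed
    finally show ?thesis .
  qed
  have small: "\<exists>n\<ge>N. ?P n < e" if e: "e > 0" for e
  proof (rule ccontr)
    assume "\<not> ?thesis"
    then have P: "?P n \<ge> e" if "N \<le> n" for n using that by force
    \<comment> \<open>\<open>Q l n\<close> is at most \<open>l * m N\<close>, and \<open>m N\<close>
      does not involve \<open>l\<close>. This \<open>l\<close> keeps \<open>Q l\<close> below
      \<open>e / 2\<close>, so a \<open>?P\<close> staying above \<open>e\<close> would force a loss
      of order \<open>1 / n\<close> forever. Adding 1 guards against \<open>m N = 0\<close>.\<close>
    define l where "l = e / (2 * (m N + 1))"
    have l: "l > 0" using e m_nonneg by (simp add: l_def)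
    have "l * m N \<le> l * (m N + 1)" using l by simp
    also have "\<dots> = e / 2"
    proof -
      have "m N + 1 \<noteq> 0" using m_nonneg by linarith
      then show ?thesis unfolding l_def times_divide_eq_left by (rule nonzero_mult_divide_mult_cancel_right)
    qed
    finally have l2: "l * m N \<le> e / 2" .
    \<comment> \<open>From this time on \<open>l \<le> sqrt n\<close>, the condition of the
      exponential estimate.\<close>
    define n0 where "n0 = max N (nat \<lceil>l\<^sup>2\<rceil>)"
    have n0: "N \<le> n \<and> l \<le> sqrt n" if "n0 \<le> n" for n
    proof -
      have "l\<^sup>2 \<le> real n" using that unfolding n0_def by linarith
      then show ?thesis using that by (simp add: n0_def real_le_rsqrt)
    qed
    show False
    proof (rule no_harmonic_decrease[of "2 * p * (1 - p) * l\<^sup>2 * (e / 2)" n0 "Q l"])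
      show "2 * p * (1 - p) * l\<^sup>2 * (e / 2) > 0" using p l e by simp
      fix n assume n: "n0 \<le> n"
      show "0 \<le> Q l n" using n0[OF n] l by (intro Q_nonneg) auto
      have "Q l n \<le> l * m n" using n0[OF n] l by (intro Q_le) auto
      also have "\<dots> \<le> l * m N" using n0[OF n] l by (intro mult_left_mono m_le) auto
      finally have "Q l n \<le> e / 2" using l2 by linarith
      then have "e / 2 \<le> ?P n - Q l n" using P[of n] n0[OF n] by auto
      then have "2 * p * (1 - p) * l\<^sup>2 / n * (e / 2) \<le> 2 * p * (1 - p) * l\<^sup>2 / n * (?P n - Q l n)"
        using p by (intro mult_left_mono) auto
      then show "Q l (Suc n) \<le> Q l n - 2 * p * (1 - p) * l\<^sup>2 * (e / 2) / n"
        using Q_Suc[of n l] n0[OF n] l by simp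
    qed
  qed
  have P_mono: "?P n' \<le> ?P n" if "n \<le> n'" "N \<le> n" for n n'
    using that by (induction rule: dec_induct)
      (use p' N in \<open>auto intro: order_trans[OF separation_prob_Suc_le]\<close>)
  show ?thesis
  proof (rule LIMSEQ_I)
    fix e :: real assume "e > 0"
    from small[OF this] obtain n where n: "n \<ge> N" "?P n < e" by blast
    have "norm (?P n' - 0) < e" if "n' \<ge> n" for n'
      using P_mono[OF that n(1)] n(2) by simp
    then show "\<exists>no. \<forall>n\<ge>no. norm (?P n - 0) < e" by blast
  qed
qed

section \<open>Meetings stop for p above 3/4\<close>

lemma separation_prob_lower_bound:
  fixes p :: real
  assumes p: "3/4 < p" "p < 1"
  obtains \<eta> :: "nat \<Rightarrow> real" where "\<eta> \<longlonglongrightarrow> 0"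
    "\<forall>\<^sub>F N in sequentially. \<forall>n\<ge>N. 1 - separation_prob p s N n \<le> \<eta> N"
proof -
  let ?E = "\<lambda>n. measure_pmf.expectation (history_pmf p s n)"
  have p': "0 \<le> p" "p \<le> 1" using p by auto
  obtain B \<rho> :: real and n0 :: nat where B: "B > 0" and \<rho>: "\<rho> > 0" and n0: "n0 \<ge> 1"
    and contr: "\<And>n a b. n \<ge> n0 \<Longrightarrow> \<bar>a\<bar> \<le> int n \<Longrightarrow> \<bar>b\<bar> \<le> int n \<Longrightarrow>
      pair_step p n (\<lambda>a b. real (Suc n) / (B * real (Suc n) + (real_of_int (a - b))\<^sup>2)) a b
      \<le> (1 - \<rho> / n) * (n / (B * n + (real_of_int (a - b))\<^sup>2))"
    by (rule pair_step_reciprocal_contraction[OF p]) (rule that)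
  define h where "h n a b = real n / (B * n + (real_of_int (a - b))\<^sup>2)" for n :: nat and a b :: int
  define H where "H n = ?E n (\<lambda>f. h n (erw_S f True n) (erw_S f False n))" for n
  have h_nonneg: "0 \<le> h n a b" for n a b using B by (simp add: h_def)
  have h_diag: "h n a a = 1 / B" if "1 \<le> n" for n a using B that by (simp add: h_def)
  have h_step: "pair_step p n (h (Suc n)) a b \<le> (1 - \<rho> / n) * h n a b"
    if "n \<ge> n0" "\<bar>a\<bar> \<le> int n" "\<bar>b\<bar> \<le> int n" for n a b
    using contr[OF that] by (simp add: h_def[abs_def])
  have h_step': "pair_step p n (h (Suc n)) a b \<le> h n a b"
    if "n \<ge> n0" "\<bar>a\<bar> \<le> int n" "\<bar>b\<bar> \<le> int n" for n a b
  proof -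
    have "(1 - \<rho> / n) * h n a b \<le> 1 * h n a b"
      using \<rho> h_nonneg by (intro mult_right_mono) auto
    then show ?thesis using h_step[OF that] by simp
  qed
  have H_nonneg: "0 \<le> H n" for n unfolding H_def using h_nonneg by (intro Bochner_Integration.integral_nonneg) auto
  have H_Suc: "H (Suc n) \<le> (1 - \<rho> / n) * H n" if n: "n \<ge> n0" for n
  proof -
    have "H (Suc n) = ?E n (\<lambda>f. pair_step p n (h (Suc n)) (erw_S f True n) (erw_S f False n))"
      unfolding H_def using n n0 expectation_step[OF p', of n "\<lambda>_. 1" s "h (Suc n)"] by simp
    also have "\<dots> \<le> ?E n (\<lambda>f. (1 - \<rho> / n) * h n (erw_S f True n) (erw_S f False n))"
      using n by (intro expectation_history_mono h_step erw_S_regular)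
    finally show ?thesis by (simp add: H_def)
  qed
  have H_mono: "H n' \<le> H n" if "n \<le> n'" "n0 \<le> n" for n n'
    using that
  proof (induction rule: dec_induct)
    case (step k)
    have "(1 - \<rho> / k) * H k \<le> 1 * H k"
      using \<rho> H_nonneg by (intro mult_right_mono) auto
    then show ?case using step H_Suc[of k] by simp
  qed simp
  \<comment> \<open>If \<open>H\<close> stayed above \<open>e\<close>, each step would lower it by
    at least \<open>\<rho> e / n\<close>.\<close>
  have H_lim: "H \<longlonglongrightarrow> 0"
  proof (rule LIMSEQ_I)
    fix e :: real assume e: "e > 0"
    have "\<exists>n\<ge>n0. H n < e"
    proof (rule ccontr)
      assume "\<not> ?thesis"
      then have He: "H n \<ge> e" if "n0 \<le> n" for n using that by force
      show False
      proof (rule no_harmonic_decrease[of "\<rho> * e" n0 H])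
        fix n assume n: "n0 \<le> n"
        have "\<rho> / n * e \<le> \<rho> / n * H n" using He[OF n] \<rho> by (intro mult_left_mono) auto
        then show "H (Suc n) \<le> H n - \<rho> * e / n" using H_Suc[OF n] by (simp add: algebra_simps)
      qed (use \<rho> e H_nonneg in auto)
    qed
    then obtain n where n: "n \<ge> n0" "H n < e" by blast
    have "norm (H n' - 0) < e" if "n' \<ge> n" for n'
      using H_mono[OF that n(1)] n(2) H_nonneg[of n'] by simp
    then show "\<exists>no. \<forall>n\<ge>no. norm (H n - 0) < e" by blast
  qed
  \<comment> \<open>The bound is uniform in \<open>n\<close>, so that \<open>n\<close> may later
    tend to infinity with \<open>N\<close> fixed.\<close>
  have bound: "1 - separation_prob p s N n \<le> B * H N" if N: "n0 \<le> N" and n: "N \<le> n" for N n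
  proof -
    \<comment> \<open>\<open>h - 1 / B\<close> vanishes at meetings, so restricting to the separated histories loses nothing.\<close>
    define F where "F n = ?E n (\<lambda>f. of_bool (separated N n f) * (h n (erw_S f True n) (erw_S f False n) - 1 / B))" for n
    have "F n \<le> F N"
      using n
    proof (induction rule: dec_induct)
      case (step k)
      have "F (Suc k) \<le> F k"
        unfolding F_def
      proof (rule expectation_separated_mono[OF p',
          where u = "\<lambda>a b. h (Suc k) a b - 1 / B" and v = "\<lambda>a b. h k a b - 1 / B"])
        fix a b assume "\<bar>a\<bar> \<le> int k" "\<bar>b\<bar> \<le> int k"
        then have "pair_step p k (h (Suc k)) a b \<le> h k a b" using step N by (intro h_step') auto
        moreover have "pair_step p k (\<lambda>a b. h (Suc k) a b - 1 / B) a b = pair_step p k (h (Suc k)) a b - pair_step p k (\<lambda>_ _. 1 / B) a b"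
          unfolding pair_step_expand by (simp add: algebra_simps diff_divide_distrib add_divide_distrib)
        ultimately show "pair_step p k (\<lambda>a b. h (Suc k) a b - 1 / B) a b \<le> h k a b - 1 / B" by simp
      qed (use step N n0 in \<open>auto simp: h_diag\<close>)
      then show ?case using step by simp
    qed simp
    also have "F N = ?E N (\<lambda>f. h N (erw_S f True N) (erw_S f False N) - 1 / B)"
      unfolding F_def using N n0
      by (intro Bochner_Integration.integral_cong refl) (auto simp: separated_def h_diag)
    also have "\<dots> = H N - 1 / B"
      unfolding H_def by (subst Bochner_Integration.integral_diff) auto
    finally have "F n \<le> H N - 1 / B" .
    \<comment> \<open>Since \<open>h\<close> is nonnegative, each separated history contributes at
      least \<open>- 1 / B\<close>.\<close>
    moreover have "?E n (\<lambda>f. - (1 / B) * of_bool (separated N n f)) \<le> F n"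
      unfolding F_def using h_nonneg by (intro expectation_history_mono) auto
    ultimately have "- (1 / B) * separation_prob p s N n \<le> H N - 1 / B"
      unfolding separation_prob_eq by simp
    then show ?thesis using B by (simp add: field_simps)
  qed
  show ?thesis
  proof (rule that)
    show "(\<lambda>N. B * H N) \<longlonglongrightarrow> 0" using tendsto_mult_left[OF H_lim, of B] by simp
    show "\<forall>\<^sub>F N in sequentially. \<forall>n\<ge>N. 1 - separation_prob p s N n \<le> B * H N"
      using bound by (auto simp: eventually_at_top_linorder)
  qed
qed

section \<open>From finite horizons to almost sure statements\<close>

theorem theorem1:
  fixes M :: "'a measure" and \<xi> :: "erw_idx \<Rightarrow> 'a \<Rightarrow> int" and p s :: real
  assumes "prob_space M"
    and "0 < p" and "p < 1" and "0 \<le> s" and "s \<le> 1"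
    and "prob_space.indep_vars M (\<lambda>_. count_space UNIV) \<xi> erw_index_set"
    and "\<forall>i\<in>erw_index_set. distr M (count_space UNIV) (\<xi> i) = measure_pmf (erw_law p s i)"
  shows "(p \<le> 3/4 \<longrightarrow>
           (AE \<omega> in M. infinite {n. erw_S (\<lambda>i. \<xi> i \<omega>) True n = erw_S (\<lambda>i. \<xi> i \<omega>) False n}))
       \<and> (3/4 < p \<longrightarrow>
           (AE \<omega> in M. finite {n. erw_S (\<lambda>i. \<xi> i \<omega>) True n = erw_S (\<lambda>i. \<xi> i \<omega>) False n}))"
proof -
  interpret prob_space M by fact
  let ?x = "\<lambda>\<omega> i. \<xi> i \<omega>"
  define A where "A N n = {\<omega> \<in> space M. separated N (Suc n) (?x \<omega>)}" for N n
  define Z where "Z N = {\<omega> \<in> space M. \<forall>k\<ge>N. erw_S (?x \<omega>) True k \<noteq> erw_S (?x \<omega>) False k}" for N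
  have ne: "hist_indices n \<noteq> {}" for n
    using in_hist_indices(1)[of True n] by blast
  have law: "distr M (count_space UNIV) (\<xi> i) = measure_pmf (erw_law p s i)" if "i \<in> hist_indices n" for i n
    using assms(7) hist_indices_subset that by blast
  have cong: "separated N (Suc n) f = separated N (Suc n) g" if "\<And>i. i \<in> hist_indices (Suc n) \<Longrightarrow> f i = g i" for N n f g
    using that by (intro separated_cong) auto
  have A: "A N n \<in> events" "prob (A N n) = separation_prob p s N (Suc n)" for N n
  proof -
    show "A N n \<in> events"
      unfolding A_def
      by (rule prob_eq_Pi_pmf(1)[OF assms(6) finite_hist_indices[of "Suc n"] ne hist_indices_subset law cong])
    show "prob (A N n) = separation_prob p s N (Suc n)"
      unfolding A_def
      by (rule prob_eq_Pi_pmf(2)[OF assms(6) finite_hist_indices[of "Suc n"] ne hist_indices_subset law cong])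
  qed
  have Z_eq: "Z N = (\<Inter>n. A N n)" for N
  proof -
    have "(\<forall>n. separated N (Suc n) f) \<longleftrightarrow> (\<forall>k\<ge>N. erw_S f True k \<noteq> erw_S f False k)" for f
    proof (intro iffI allI impI)
      fix k assume "\<forall>n. separated N (Suc n) f" "N \<le> k"
      then show "erw_S f True k \<noteq> erw_S f False k"
        by (auto simp: separated_def dest!: spec[of _ k])
    qed (simp add: separated_def)
    then show ?thesis by (auto simp: Z_def A_def)
  qed
  have Z[measurable]: "Z N \<in> events" for N
    unfolding Z_eq using A(1) by auto
  have Z_lim: "(\<lambda>n. separation_prob p s N (Suc n)) \<longlonglongrightarrow> prob (Z N)" for N
    unfolding Z_eq A(2)[symmetric]
    by (intro finite_Lim_measure_decseq) (use A(1) in \<open>auto simp: decseq_def A_def separated_def\<close>)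
  show ?thesis
  proof (intro conjI impI)
    assume p: "p \<le> 3/4"
    have "AE \<omega> in M. \<omega> \<notin> Z N" if "2 \<le> N" for N
    proof -
      have "prob (Z N) = 0"
        using LIMSEQ_unique[OF Z_lim LIMSEQ_Suc[OF separation_prob_tendsto_0[OF assms(2) p that]]] .
      then show ?thesis using Z by (simp add: prob_eq_0)
    qed
    then have "AE \<omega> in M. \<forall>N\<in>{2..}. \<omega> \<notin> Z N"
      by (subst AE_ball_countable) auto
    then show "AE \<omega> in M. infinite {n. erw_S (?x \<omega>) True n = erw_S (?x \<omega>) False n}"
    proof (rule AE_mp, intro AE_I2 impI)
      fix \<omega> assume \<omega>: "\<omega> \<in> space M" "\<forall>N\<in>{2..}. \<omega> \<notin> Z N"
      have "\<exists>k\<ge>N. erw_S (?x \<omega>) True k = erw_S (?x \<omega>) False k" for N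
      proof -
        \<comment> \<open>The null sets start at time 2, where the normalisation
          \<open>sqrt (N - 1)\<close> becomes positive.\<close>
        have "\<omega> \<notin> Z (N + 2)" using \<omega>(2) by auto
        then obtain k where "N + 2 \<le> k" "erw_S (?x \<omega>) True k = erw_S (?x \<omega>) False k"
          using \<omega>(1) by (auto simp: Z_def)
        then show ?thesis by (intro exI[of _ k]) auto
      qed
      then show "infinite {n. erw_S (?x \<omega>) True n = erw_S (?x \<omega>) False n}"
        by (auto simp: infinite_nat_iff_unbounded_le)
    qed
  next
    assume p: "3/4 < p"
    obtain \<eta> :: "nat \<Rightarrow> real" where \<eta>: "\<eta> \<longlonglongrightarrow> 0"
      "\<forall>\<^sub>F N in sequentially. \<forall>n\<ge>N. 1 - separation_prob p s N n \<le> \<eta> N"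
      by (rule separation_prob_lower_bound[OF p assms(3)]) (rule that)
    \<comment> \<open>The right side no longer depends on \<open>N\<close>, so letting
      \<open>\<eta>\<close> tend to 0 gives probability one.\<close>
    have "\<forall>\<^sub>F N in sequentially. 1 - \<eta> N \<le> prob (\<Union>N. Z N)"
      using \<eta>(2)
    proof eventually_elim
      case (elim N)
      have "1 - \<eta> N \<le> prob (Z N)"
        by (rule LIMSEQ_le_const[OF Z_lim]) (use elim in \<open>auto intro!: exI[of _ N] simp: algebra_simps\<close>)
      also have "\<dots> \<le> prob (\<Union>N. Z N)" by (intro finite_measure_mono) auto
      finally show ?case .
    qed
    then have "1 - 0 \<le> prob (\<Union>N. Z N)"
      by (intro tendsto_le[OF sequentially_bot tendsto_const tendsto_diff[OF tendsto_const \<eta>(1)]])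
    then have "prob (\<Union>N. Z N) = 1" using prob_le_1[of "\<Union>N. Z N"] by linarith
    then have "AE \<omega> in M. \<omega> \<in> (\<Union>N. Z N)"
      by (subst AE_in_set_eq_1) auto
    then show "AE \<omega> in M. finite {n. erw_S (?x \<omega>) True n = erw_S (?x \<omega>) False n}"
    proof (rule AE_mp, intro AE_I2 impI)
      fix \<omega> assume "\<omega> \<in> (\<Union>N. Z N)"
      then obtain N where "\<And>k. N \<le> k \<Longrightarrow> erw_S (?x \<omega>) True k \<noteq> erw_S (?x \<omega>) False k"
        by (auto simp: Z_def)
      then have "{n. erw_S (?x \<omega>) True n = erw_S (?x \<omega>) False n} \<subseteq> {..N}"
        by (force simp: not_le[symmetric] intro: less_imp_le)
      then show "finite {n. erw_S (?x \<omega>) True n = erw_S (?x \<omega>) False n}"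
        by (rule finite_subset) simp
    qed
  qed
qed

end
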